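(* Let $\mathbb{F}$ be an algebraically closed field of characteristic zero, $k\ge1$, $n=2k+2$, $\lambda\in(\mathbb{F}^\times)^k$. Two fine gradings $\Gamma=\Gamma(l,s,r;\beta_1,\dots,\beta_s,\alpha_1,\dots,\alpha_r)$ and $\Gamma'=\Gamma(l',s',r';\beta'_1,\dots,\beta'_{s'},\alpha'_1,\dots,\alpha'_{r'})$ on the twisted Heisenberg algebra $H_n^\lambda$ are equivalent if and only if $l=l'$, $s=s'$, $r=r'$ and there are $\varepsilon\in\mathbb{F}^\times$, $\eta\in S_s$ and $\sigma\in S_r$ such that: for all $j=1,\dots,s$, $\widehat{\varepsilon\beta'_j}=\widehat{\beta_{\eta(j)}}$ if $l$ is even and $\widetilde{\varepsilon\beta'_j}=\widetilde{\beta_{\eta(j)}}$ if $l$ is odd; and for all $i=1,\dots,r$, $\widehat{\varepsilon\alpha'_i}=\widehat{\alpha_{\sigma(i)}}$.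
   Context: For $\alpha\in\mathbb{F}^\times$ and the integer $l\geq 1$ at hand, $\widehat\alpha=\{\alpha\xi^t:0\le t\le l-1\}$ and $\widetilde\alpha=\{\alpha\zeta^t:0\le t\le 2l-1\}$, where $\xi$ and $\zeta$ are primitive $l$-th and $2l$-th roots of unity; so $\widehat\alpha=\widehat\beta$ iff $(\alpha/\beta)^l=1$ and $\widetilde\alpha=\widetilde\beta$ iff $(\alpha/\beta)^{2l}=1$. The twisted Heisenberg algebra $H_n^\lambda$ ($n=2k+2$, $\lambda=(\lambda_1,\dots,\lambda_k)$) is the Lie algebra with basis $\{z,u,e_1,\hat e_1,\dots,e_k,\hat e_k\}$ whose nonvanishing brackets (up to skew-symmetry) are $[e_i,\hat e_i]=\lambda_iz$, $[u,e_i]=\lambda_i\hat e_i$, $[u,\hat e_i]=\lambda_ie_i$, $1\le i\le k$. Blocks. Let $L$ be a Lie algebra, $z\in L$ a fixed element, $u\in L$, $\alpha\in\mathbb{F}^\times$, $l\ge1$. A block of type I, $B_l^{\mathrm{I}}(u,\alpha)=\{x_1,y_1,\dots,x_l,y_l\}$, is a family of $2l$ linearly independent elements of $L$ such that the only nonvanishing products (up to skew-symmetry) among $u$ and these elements are: $[u,x_i]=\alpha x_{i+1}$ and $[u,y_i]=\alpha y_{i+1}$ for $1\le i\le l-1$; $[u,x_l]=\alpha x_1$; $[u,y_l]=(-1)^l\alpha y_1$; $[x_i,y_{l-i}]=(-1)^{l-i}\alpha z$ for $1\le i\le l-1$; $[x_l,y_l]=(-1)^l\alpha z$. A block of type II,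 $B_l^{\mathrm{II}}(u,\alpha)=\{x_1,\dots,x_{2l}\}$, is a family of $2l$ linearly independent elements of $L$ such that the only nonvanishing products (up to skew-symmetry) among $u$ and these elements are: $[u,x_i]=\alpha x_{i+1}$ for $1\le i\le 2l$ (indices modulo $2l$); $[x_i,x_{2l-i+1}]=(-1)^i\alpha z$ for $1\le i\le 2l$. For integers $l\ge1$, $s,r\ge0$ with $l(r+2s)=2k$ ($l$ even if $r\ne0$) and scalars $\beta_j,\alpha_i\in\{\pm\lambda_1,\dots,\pm\lambda_k\}$, $\Gamma(l,s,r;\beta_1,\dots,\beta_s,\alpha_1,\dots,\alpha_r)$ denotes (when it exists) the grading on $L=H_n^\lambda$ whose homogeneous components are the lines spanned by the elements of a basis of $L$ of the form $\{z,u\}\cup\bigcup_{j=1}^sB_l^{\mathrm{I}}(u,\beta_j)\cup\bigcup_{i=1}^rB_{l/2}^{\mathrm{II}}(u,\alpha_i)$, where $0\ne z$ is central, $u\in L$, and brackets of elements belonging to different blocks are zero. These gradings are fine (they admit no proper refinement among group gradings by abelian groups). Two gradings on an algebra are equivalent if some automorphism of the algebra maps the set of homogeneous components of the first bijectively onto that of the second. *)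

theory Defs
  imports
    "HOL-Analysis.Analysis"
    "HOL-Algebra.Group"
    "HOL-Combinatorics.Permutations"
    "HOL-Computational_Algebra.Polynomial"
begin

section \<open>The twisted Heisenberg algebra\<close>

text \<open>
  The index type labels the basis z, u, e_i, hat e_i. The index set {1..k} of the pairs is rendered by
  a finite type, so k is the cardinality of that type and k is at least 1.
\<close>

datatype 'k heis_index = Z_ix | U_ix | E_ix 'k | Ehat_ix 'k

lemma UNIV_heis_index:
  "(UNIV :: 'k heis_index set) = {Z_ix, U_ix} \<union> range E_ix \<union> range Ehat_ix"
proof -
  have "x \<in> {Z_ix, U_ix} \<union> range E_ix \<union> range Ehat_ix" for x :: "'k heis_index"
    by (cases x) auto
  then show ?thesis by blast
qed

instance heis_index :: (finite) finite
  by standard (simp add: UNIV_heis_index)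

lemma sum_heis_index:
  fixes f :: "'k::finite heis_index \<Rightarrow> 'a::comm_monoid_add"
  shows "sum f UNIV = f Z_ix + f U_ix + (\<Sum>i\<in>UNIV. f (E_ix i)) + (\<Sum>i\<in>UNIV. f (Ehat_ix i))"
proof -
  have "sum f UNIV = sum f {Z_ix, U_ix} + sum f (range E_ix) + sum f (range Ehat_ix)"
    unfolding UNIV_heis_index
    by (subst sum.union_disjoint; (subst sum.union_disjoint)?) auto
  also have "sum f (range E_ix) = (\<Sum>i\<in>UNIV. f (E_ix i))"
    by (subst sum.reindex) (auto intro: injI)
  also have "sum f (range Ehat_ix) = (\<Sum>i\<in>UNIV. f (Ehat_ix i))"
    by (subst sum.reindex) (auto intro: injI)
  finally show ?thesis by simp
qed

lemma card_heis_index: "CARD('k::finite heis_index) = 2 * CARD('k) + 2"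
  using sum_heis_index[of "\<lambda>_::'k heis_index. 1::nat"] by simp

type_synonym ('f, 'k) heis = "('f, 'k heis_index) vec"

fun heis_basis_bracket ::
  "'f::field ^ 'k::finite \<Rightarrow> 'k heis_index \<Rightarrow> 'k heis_index \<Rightarrow> ('f, 'k) heis" where
  "heis_basis_bracket lam (E_ix i) (Ehat_ix j) = (if i = j then (lam $ i) *s axis Z_ix 1 else 0)"
| "heis_basis_bracket lam (Ehat_ix j) (E_ix i) = (if i = j then - (lam $ i) *s axis Z_ix 1 else 0)"
| "heis_basis_bracket lam U_ix (E_ix i) = (lam $ i) *s axis (Ehat_ix i) 1"
| "heis_basis_bracket lam (E_ix i) U_ix = - (lam $ i) *s axis (Ehat_ix i) 1"
| "heis_basis_bracket lam U_ix (Ehat_ix i) = (lam $ i) *s axis (E_ix i) 1"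
| "heis_basis_bracket lam (Ehat_ix i) U_ix = - (lam $ i) *s axis (E_ix i) 1"
| "heis_basis_bracket lam _ _ = 0"

definition heis_bracket ::
  "'f::field ^ 'k::finite \<Rightarrow> ('f, 'k) heis \<Rightarrow> ('f, 'k) heis \<Rightarrow> ('f, 'k) heis" where
  "heis_bracket lam x y =
     (\<Sum>a\<in>UNIV. \<Sum>b\<in>UNIV. (x $ a * y $ b) *s heis_basis_bracket lam a b)"

lemma heis_bracket_nth:
  fixes lam :: "'f::field ^ 'k::finite"
  shows "heis_bracket lam x y $ Z_ix =
      (\<Sum>i\<in>UNIV. lam $ i * (x $ E_ix i * y $ Ehat_ix i - x $ Ehat_ix i * y $ E_ix i))"
    and "heis_bracket lam x y $ U_ix = 0"
    and "heis_bracket lam x y $ E_ix i =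
      lam $ i * (x $ U_ix * y $ Ehat_ix i - x $ Ehat_ix i * y $ U_ix)"
    and "heis_bracket lam x y $ Ehat_ix i =
      lam $ i * (x $ U_ix * y $ E_ix i - x $ E_ix i * y $ U_ix)"
  by (simp_all add: heis_bracket_def sum_heis_index axis_def sum.distrib if_distrib
      [where f = "\<lambda>v. v $ _"] if_distrib[where f = "\<lambda>c. _ * c"] sum_subtractf sum_negf
      algebra_simps cong: if_cong)

lemma heis_eqI:
  fixes v w :: "('f, 'k::finite) heis"
  assumes "v $ Z_ix = w $ Z_ix" "v $ U_ix = w $ U_ix"
    and "\<And>i. v $ E_ix i = w $ E_ix i" "\<And>i. v $ Ehat_ix i = w $ Ehat_ix i"
  shows "v = w"
proof -
  have "v $ a = w $ a" for a
    using assms by (cases a) auto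
  then show ?thesis by (simp add: vec_eq_iff)
qed

lemma heis_bracket_self: "heis_bracket lam x x = 0"
  by (rule heis_eqI) (simp_all add: heis_bracket_nth)

lemma heis_bracket_jacobi:
  "heis_bracket lam x (heis_bracket lam y w) + heis_bracket lam y (heis_bracket lam w x) +
   heis_bracket lam w (heis_bracket lam x y) = 0"
  by (rule heis_eqI)
    (simp_all add: heis_bracket_nth sum.distrib[symmetric] algebra_simps)

lemma heis_bracket_bilinear:
  "heis_bracket lam (c *s x + y) w = c *s heis_bracket lam x w + heis_bracket lam y w"
  "heis_bracket lam w (c *s x + y) = c *s heis_bracket lam w x + heis_bracket lam w y"
  by (rule heis_eqI;
    simp add: heis_bracket_nth sum.distrib[symmetric] sum_distrib_left algebra_simps)+


section \<open>Gradings on an algebra with a given product\<close>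

text \<open>
  A grading is represented by its set of (nonzero) homogeneous components. A grading has finitely
  many of them, and their degrees generate a countable subgroup; hence restricting the grading
  group to abelian groups with carrier in the natural numbers loses no generality.
\<close>

definition direct_decomposition :: "('f::field ^ 'n::finite) set set \<Rightarrow> bool" where
  "direct_decomposition \<Gamma> \<longleftrightarrow>
     finite \<Gamma> \<and> (\<forall>V\<in>\<Gamma>. vec.subspace V \<and> V \<noteq> {0}) \<and>
     (\<forall>v. \<exists>!c. c \<in> (\<Pi>\<^sub>E V\<in>\<Gamma>. V) \<and> v = (\<Sum>V\<in>\<Gamma>. c V))"

definition group_grading ::
  "('f::field ^ 'n::finite \<Rightarrow> 'f ^ 'n \<Rightarrow> 'f ^ 'n) \<Rightarrow> ('f ^ 'n) set set \<Rightarrow> bool" where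
  "group_grading br \<Gamma> \<longleftrightarrow>
     direct_decomposition \<Gamma> \<and>
     (\<exists>(G :: nat monoid) deg.
        comm_group G \<and> deg \<in> \<Gamma> \<rightarrow> carrier G \<and> inj_on deg \<Gamma> \<and>
        (\<forall>V\<in>\<Gamma>. \<forall>W\<in>\<Gamma>. \<forall>v\<in>V. \<forall>w\<in>W.
           br v w = 0 \<or> (\<exists>X\<in>\<Gamma>. deg X = deg V \<otimes>\<^bsub>G\<^esub> deg W \<and> br v w \<in> X)))"

definition refines :: "'a set set \<Rightarrow> 'a set set \<Rightarrow> bool" where
  "refines \<Gamma>' \<Gamma> \<longleftrightarrow> (\<forall>V\<in>\<Gamma>'. \<exists>W\<in>\<Gamma>. V \<subseteq> W)"

definition fine_grading ::
  "('f::field ^ 'n::finite \<Rightarrow> 'f ^ 'n \<Rightarrow> 'f ^ 'n) \<Rightarrow> ('f ^ 'n) set set \<Rightarrow> bool" where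
  "fine_grading br \<Gamma> \<longleftrightarrow>
     group_grading br \<Gamma> \<and> (\<forall>\<Gamma>'. group_grading br \<Gamma>' \<and> refines \<Gamma>' \<Gamma> \<longrightarrow> \<Gamma>' = \<Gamma>)"

definition algebra_automorphism ::
  "('f::field ^ 'n::finite \<Rightarrow> 'f ^ 'n \<Rightarrow> 'f ^ 'n) \<Rightarrow> ('f ^ 'n \<Rightarrow> 'f ^ 'n) \<Rightarrow> bool" where
  "algebra_automorphism br f \<longleftrightarrow>
     Vector_Spaces.linear (*s) (*s) f \<and> bij f \<and> (\<forall>v w. f (br v w) = br (f v) (f w))"

definition equivalent_gradings ::
  "('f::field ^ 'n::finite \<Rightarrow> 'f ^ 'n \<Rightarrow> 'f ^ 'n) \<Rightarrow> ('f ^ 'n) set set \<Rightarrow> ('f ^ 'n) set set \<Rightarrow> bool"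
  where
  "equivalent_gradings br \<Gamma> \<Gamma>' \<longleftrightarrow>
     (\<exists>f. algebra_automorphism br f \<and> bij_betw (\<lambda>V. f ` V) \<Gamma> \<Gamma>')"


section \<open>Blocks\<close>

definition block_I ::
  "('f::field ^ 'n::finite \<Rightarrow> 'f ^ 'n \<Rightarrow> 'f ^ 'n) \<Rightarrow> 'f ^ 'n \<Rightarrow> 'f ^ 'n \<Rightarrow> 'f \<Rightarrow> nat \<Rightarrow>
   (nat \<Rightarrow> 'f ^ 'n) \<Rightarrow> (nat \<Rightarrow> 'f ^ 'n) \<Rightarrow> bool" where
  "block_I br z u \<alpha> l x y \<longleftrightarrow>
     inj_on x {1..l} \<and> inj_on y {1..l} \<and> x ` {1..l} \<inter> y ` {1..l} = {} \<and>
     vec.independent (x ` {1..l} \<union> y ` {1..l}) \<and>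
     (\<forall>i\<in>{1..<l}. br u (x i) = \<alpha> *s x (i + 1) \<and> br u (y i) = \<alpha> *s y (i + 1)) \<and>
     br u (x l) = \<alpha> *s x 1 \<and>
     br u (y l) = ((-1) ^ l * \<alpha>) *s y 1 \<and>
     (\<forall>i\<in>{1..<l}. br (x i) (y (l - i)) = ((-1) ^ (l - i) * \<alpha>) *s z) \<and>
     br (x l) (y l) = ((-1) ^ l * \<alpha>) *s z \<and>
     (\<forall>i\<in>{1..l}. \<forall>j\<in>{1..l}. br (x i) (x j) = 0 \<and> br (y i) (y j) = 0) \<and>
     (\<forall>i\<in>{1..l}. \<forall>j\<in>{1..l}. i + j \<noteq> l \<and> \<not> (i = l \<and> j = l) \<longrightarrow> br (x i) (y j) = 0)"

definition block_II ::
  "('f::field ^ 'n::finite \<Rightarrow> 'f ^ 'n \<Rightarrow> 'f ^ 'n) \<Rightarrow> 'f ^ 'n \<Rightarrow> 'f ^ 'n \<Rightarrow> 'f \<Rightarrow> nat \<Rightarrow>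
   (nat \<Rightarrow> 'f ^ 'n) \<Rightarrow> bool" where
  "block_II br z u \<alpha> l x \<longleftrightarrow>
     inj_on x {1..2 * l} \<and> vec.independent (x ` {1..2 * l}) \<and>
     (\<forall>i\<in>{1..2 * l}. br u (x i) = \<alpha> *s x (i mod (2 * l) + 1)) \<and>
     (\<forall>i\<in>{1..2 * l}. br (x i) (x (2 * l - i + 1)) = ((-1) ^ i * \<alpha>) *s z) \<and>
     (\<forall>i\<in>{1..2 * l}. \<forall>j\<in>{1..2 * l}. j \<noteq> 2 * l - i + 1 \<longrightarrow> br (x i) (x j) = 0)"


section \<open>The gradings given by bases of blocks\<close>

text \<open>
  The blocks below list l(2s+r) = 2k vectors, so a basis of the (2k+2)-dimensional algebra formed
  by them together with z and u forces all the listed vectors to be distinct; in particular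
  different blocks are disjoint.
\<close>

definition is_block_grading ::
  "'f::field ^ 'k::finite \<Rightarrow> nat \<Rightarrow> nat \<Rightarrow> nat \<Rightarrow> (nat \<Rightarrow> 'f) \<Rightarrow> (nat \<Rightarrow> 'f) \<Rightarrow>
   ('f, 'k) heis set set \<Rightarrow> bool" where
  "is_block_grading lam l s r \<beta> \<alpha> \<Gamma> \<longleftrightarrow>
     l \<ge> 1 \<and> l * (r + 2 * s) = 2 * CARD('k) \<and> (r \<noteq> 0 \<longrightarrow> even l) \<and>
     (\<forall>j\<in>{1..s}. \<exists>m. \<beta> j = lam $ m \<or> \<beta> j = - (lam $ m)) \<and>
     (\<forall>i\<in>{1..r}. \<exists>m. \<alpha> i = lam $ m \<or> \<alpha> i = - (lam $ m)) \<and>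
     (\<exists>z u x y w.
        let br = heis_bracket lam;
            P = (\<lambda>j. x j ` {1..l} \<union> y j ` {1..l});
            Q = (\<lambda>i. w i ` {1..l});
            B = {z, u} \<union> (\<Union>j\<in>{1..s}. P j) \<union> (\<Union>i\<in>{1..r}. Q i)
        in z \<noteq> 0 \<and> (\<forall>v. br z v = 0) \<and>
           (\<forall>j\<in>{1..s}. block_I br z u (\<beta> j) l (x j) (y j)) \<and>
           (\<forall>i\<in>{1..r}. block_II br z u (\<alpha> i) (l div 2) (w i)) \<and>
           (\<forall>j\<in>{1..s}. \<forall>j'\<in>{1..s}. j \<noteq> j' \<longrightarrow> (\<forall>v\<in>P j. \<forall>v'\<in>P j'. br v v' = 0)) \<and>
           (\<forall>i\<in>{1..r}. \<forall>i'\<in>{1..r}. i \<noteq> i' \<longrightarrow> (\<forall>v\<in>Q i. \<forall>v'\<in>Q i'. br v v' = 0)) \<and>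
           (\<forall>j\<in>{1..s}. \<forall>i\<in>{1..r}. \<forall>v\<in>P j. \<forall>v'\<in>Q i. br v v' = 0) \<and>
           vec.independent B \<and> vec.span B = UNIV \<and>
           \<Gamma> = (\<lambda>v. vec.span {v}) ` B)"


section \<open>Classes of scalars modulo roots of unity\<close>

definition primitive_root_of_unity :: "nat \<Rightarrow> 'f::field \<Rightarrow> bool" where
  "primitive_root_of_unity m \<xi> \<longleftrightarrow> \<xi> ^ m = 1 \<and> (\<forall>t. 0 < t \<and> t < m \<longrightarrow> \<xi> ^ t \<noteq> 1)"

text \<open>
  The set does not depend on the chosen primitive root, which exists for positive m over an
  algebraically closed field of characteristic zero.
\<close>

definition root_class :: "nat \<Rightarrow> 'f::field \<Rightarrow> 'f set" where
  "root_class m \<alpha> = (let \<xi> = (SOME \<xi>. primitive_root_of_unity m \<xi>) in {\<alpha> * \<xi> ^ t |t. t < m})"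

definition hat_class :: "nat \<Rightarrow> 'f::field \<Rightarrow> 'f set" where
  "hat_class l \<alpha> = root_class l \<alpha>"

definition tilde_class :: "nat \<Rightarrow> 'f::field \<Rightarrow> 'f set" where
  "tilde_class l \<alpha> = root_class (2 * l) \<alpha>"

end

theory Submission
  imports Defs "HOL-Computational_Algebra.Primes"
begin

text \<open>
  Apart from \<open>z\<close> and \<open>u\<close>, the basis of a block grading falls into cycles that \<open>ad u\<close> permutes up to
  scalars, all of length \<open>l\<close>: the two halves of a type I block and the whole of a type II block.
  On a cycle with scalar \<open>\<gamma>\<close> the power \<open>(ad u)^l\<close> is multiplication by \<open>\<gamma>^l\<close>, or by \<open>(-\<gamma>)^l\<close> on the
  second half of a type I block. The bracket pairs every cycle with exactly one cycle, its dual: the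
  halves of a type I block are dual to each other and a type II block is dual to itself.

  An automorphism that maps one such grading to another permutes the basis lines. It fixes the line
  of \<open>u\<close>, the only basis element \<open>v\<close> for which \<open>(ad v)^3\<close> does not kill the whole basis, and then
  the central line of \<open>z\<close>. Say \<open>f u = \<epsilon> u'\<close>. Then \<open>f\<close> intertwines \<open>ad u\<close> with \<open>\<epsilon> ad u'\<close>, so it maps
  cycles to cycles of the same length, respects duality, and the scalars of \<open>(ad u)^l\<close> and
  \<open>(\<epsilon> ad u')^l\<close> on corresponding cycles agree
  (\<open>equivalent_gradings_imp_cycle_bijection\<close>). Self-dual cycles go to self-dual cycles and dual pairs
  to dual pairs, which gives \<open>r = r'\<close>, \<open>s = s'\<close> and the permutations \<open>\<sigma>\<close> and \<open>\<eta>\<close>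
  (\<open>dual_equivariant_bijection\<close>). Only for odd \<open>l\<close> do the halves of a type I block carry different
  scalars \<open>\<plusminus>\<beta>^l\<close>; as \<open>f\<close> may swap them, just \<open>\<beta>^(2l)\<close> is determined.

  Conversely, if the powers agree for \<open>\<epsilon>\<close>, put \<open>q = \<epsilon> \<gamma>'/\<gamma>\<close> for corresponding cycles with scalars
  \<open>\<gamma>\<close> and \<open>\<gamma>'\<close>. The automorphism multiplies \<open>u\<close> and \<open>z\<close> by \<open>\<epsilon>\<close> and sends the \<open>i\<close>-th element of a cycle
  to a constant times \<open>q^i\<close> times the \<open>i\<close>-th element of the corresponding cycle, the halves of a type
  I block being swapped when \<open>q^l = -1\<close> (\<open>equivalent_gradings_if_scalars_match\<close>).

  Finally, classes modulo \<open>m\<close>-th roots of unity are equal exactly when \<open>m\<close>-th powers are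
  (\<open>root_class_eq_iff\<close>), which rests on the existence of primitive roots of unity.
\<close>

section \<open>Classes modulo roots of unity\<close>

lemma primitive_root_power_eq_1_iff:
  fixes \<xi> :: "'f::field"
  assumes "primitive_root_of_unity m \<xi>" "0 < m"
  shows "\<xi> ^ t = 1 \<longleftrightarrow> m dvd t"
proof -
  have one: "\<xi> ^ m = 1" using assms by (simp add: primitive_root_of_unity_def)
  have "\<xi> ^ t = \<xi> ^ (m * (t div m) + t mod m)" by simp
  also have "\<dots> = \<xi> ^ (t mod m)" by (simp only: power_add power_mult one power_one mult_1)
  finally have "\<xi> ^ t = \<xi> ^ (t mod m)" .
  moreover have "t mod m < m" using assms by simp
  ultimately show ?thesis
    using assms unfolding primitive_root_of_unity_def
    by (metis dvd_eq_mod_eq_0 gr_zeroI power_0)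
qed

lemma primitive_root_of_unityI:
  fixes \<xi> :: "'f::field"
  assumes "\<And>t. \<xi> ^ t = 1 \<longleftrightarrow> m dvd t"
  shows "primitive_root_of_unity m \<xi>"
  using assms by (auto simp: primitive_root_of_unity_def dest: nat_dvd_not_less)

text \<open>
  A root of \<open>1 + X + \<dots> + X^(p-1)\<close> works: it is a \<open>p\<close>-th root of unity, and it is not \<open>1\<close> because
  \<open>p\<close> is nonzero in characteristic zero.
\<close>

lemma exists_primitive_root_of_prime_order:
  assumes "prime (p::nat)"
  shows "\<exists>\<omega> :: 'f::{alg_closed_field, field_char_0}. primitive_root_of_unity p \<omega>"
proof -
  let ?P = "\<Sum>k<p. monom (1::'f) k"
  have coeff: "coeff ?P k = (if k < p then 1 else 0)" for k
    by (simp add: coeff_sum if_distrib cong: if_cong)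
  have "1 < p" using assms by (rule prime_gt_1_nat)
  then have "1 \<le> degree ?P" by (intro le_degree) (simp add: coeff)
  then obtain \<omega> where root: "poly ?P \<omega> = 0" using alg_closed_imp_poly_has_root[of ?P] by auto
  then have sum0: "(\<Sum>k<p. \<omega> ^ k) = 0" by (simp add: poly_sum poly_monom)
  have ne: "\<omega> \<noteq> 1"
  proof
    assume "\<omega> = 1"
    with sum0 have "of_nat p = (0::'f)" by simp
    with \<open>1 < p\<close> show False by simp
  qed
  have one: "\<omega> ^ p = 1"
    using power_diff_1_eq[of \<omega> p] sum0 by simp
  show ?thesis
  proof (intro exI primitive_root_of_unityI iffI)
    fix t assume t: "\<omega> ^ t = 1"
    show "p dvd t"
    proof (rule ccontr)
      assume "\<not> p dvd t"
      then have cop: "coprime t p" using assms by (meson coprime_commute prime_imp_coprime)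
      have "t \<noteq> 0" using \<open>\<not> p dvd t\<close> by (metis dvd_0_right)
      then obtain x y where "t * x = p * y + 1"
        using bezout_nat[of t p] cop by auto
      then have "\<omega> ^ (t * x) = \<omega> ^ (p * y + 1)" by simp
      then show False using t one ne by (simp add: power_mult power_add)
    qed
  next
    fix t assume "p dvd t"
    then show "\<omega> ^ t = 1" using one by (auto simp: power_mult elim!: dvdE)
  qed
qed

text \<open>
  Split off a prime: \<open>m = p * n\<close>, with a primitive \<open>n\<close>-th root \<open>\<zeta>\<close> at hand. If \<open>p\<close> divides \<open>n\<close>, any
  \<open>p\<close>-th root of \<open>\<zeta>\<close> is primitive of order \<open>m\<close>; otherwise multiply \<open>\<zeta>\<close> by a primitive \<open>p\<close>-th root,
  the orders being coprime.
\<close>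

lemma exists_primitive_root_of_unity:
  assumes "0 < m"
  shows "\<exists>\<xi> :: 'f::{alg_closed_field, field_char_0}. primitive_root_of_unity m \<xi>"
  using assms
proof (induction m rule: less_induct)
  case (less m)
  show ?case
  proof (cases "m = 1")
    case True
    then show ?thesis by (auto simp: primitive_root_of_unity_def)
  next
    case False
    then obtain p where p: "prime p" "p dvd m" using prime_factor_nat by blast
    then obtain n where m: "m = p * n" by (elim dvdE)
    have "1 < p" using p(1) by (rule prime_gt_1_nat)
    have n: "0 < n" "n < m" using less.prems m \<open>1 < p\<close> by auto
    then obtain \<zeta> :: 'f where \<zeta>: "primitive_root_of_unity n \<zeta>" using less.IH by blast
    note \<zeta>_iff = primitive_root_power_eq_1_iff[OF \<zeta> n(1)]
    show ?thesis
    proof (cases "p dvd n")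
      case True
      then obtain j where j: "n = p * j" by (elim dvdE)
      obtain \<xi> where \<xi>: "\<xi> ^ p = \<zeta>" using nth_root_exists[of p \<zeta>] \<open>1 < p\<close> by auto
      have *: "\<xi> ^ (p * t) = 1 \<longleftrightarrow> n dvd t" for t
        by (simp add: power_mult \<xi> \<zeta>_iff)
      have "\<xi> ^ t = 1 \<longleftrightarrow> m dvd t" for t
      proof
        assume t: "\<xi> ^ t = 1"
        then have "\<xi> ^ (p * t) = 1" by (simp only: mult.commute[of p] power_mult power_one)
        then have "p dvd t" using True * dvd_trans by blast
        then obtain i where i: "t = p * i" by (elim dvdE)
        then show "m dvd t" using t * m by simp
      next
        assume "m dvd t"
        then obtain i where "t = p * (n * i)" using m by (metis dvdE mult.assoc)
        then show "\<xi> ^ t = 1" using * by simp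
      qed
      then show ?thesis using primitive_root_of_unityI by blast
    next
      case False
      obtain \<omega> :: 'f where \<omega>: "primitive_root_of_unity p \<omega>"
        using exists_primitive_root_of_prime_order[OF p(1)] by blast
      note \<omega>_iff = primitive_root_power_eq_1_iff[OF \<omega>]
      have \<omega>_iff: "\<omega> ^ t = 1 \<longleftrightarrow> p dvd t" for t using \<omega>_iff \<open>1 < p\<close> by simp
      have cop: "coprime p n" using p(1) False by (rule prime_imp_coprime)
      have "(\<zeta> * \<omega>) ^ t = 1 \<longleftrightarrow> m dvd t" for t
      proof
        assume t: "(\<zeta> * \<omega>) ^ t = 1"
        then have "(\<zeta> * \<omega>) ^ (t * p) = 1" by (simp add: power_mult)
        moreover have "\<omega> ^ (t * p) = 1" by (simp add: \<omega>_iff)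
        ultimately have "\<zeta> ^ (t * p) = 1" by (simp add: power_mult_distrib)
        then have nt: "n dvd t" using cop
          by (simp add: \<zeta>_iff coprime_commute coprime_dvd_mult_left_iff)
        then have "\<zeta> ^ t = 1" by (simp add: \<zeta>_iff)
        then have "p dvd t" using t by (simp add: power_mult_distrib \<omega>_iff)
        then show "m dvd t" using nt cop m by (simp add: divides_mult)
      next
        assume "m dvd t"
        then have "p dvd t" "n dvd t" using m by (auto elim: dvd_mult_left dvd_mult_right)
        then have "\<zeta> ^ t = 1" "\<omega> ^ t = 1" by (simp_all add: \<zeta>_iff \<omega>_iff)
        then show "(\<zeta> * \<omega>) ^ t = 1" by (simp add: power_mult_distrib)
      qed
      then show ?thesis using primitive_root_of_unityI by blast
    qed
  qed
qed

text \<open>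
  The powers of \<open>\<xi>\<close> are \<open>m\<close> distinct roots of \<open>X^m - 1\<close>, which has no more than \<open>m\<close> roots.
\<close>

lemma roots_of_unity_eq_powers:
  fixes \<xi> :: "'f::field"
  assumes "primitive_root_of_unity m \<xi>" "0 < m"
  shows "{x. x ^ m = 1} = (\<lambda>t. \<xi> ^ t) ` {..<m}"
proof -
  note iff = primitive_root_power_eq_1_iff[OF assms]
  let ?p = "monom 1 m - 1 :: 'f poly"
  have eq: "{x. x ^ m = 1} = {x. poly ?p x = 0}" by (simp add: poly_monom)
  have "coeff ?p m = 1" using assms(2) by simp
  then have nz: "?p \<noteq> 0" by (metis coeff_0 zero_neq_one)
  have "degree ?p \<le> m" by (intro degree_diff_le) (simp_all add: degree_monom_le)
  then have le: "card {x::'f. x ^ m = 1} \<le> m"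
    unfolding eq using card_poly_roots_bound[OF nz] by linarith
  have fin: "finite {x::'f. x ^ m = 1}" unfolding eq by (rule poly_roots_finite[OF nz])
  have nz: "\<xi> \<noteq> 0" using assms iff[of m] by (cases "\<xi> = 0") (auto simp: power_0_left)
  have inj: "inj_on (\<lambda>t. \<xi> ^ t) {..<m}"
  proof (rule linorder_inj_onI)
    fix i j assume ij: "i < j" "i \<in> {..<m}" "j \<in> {..<m}"
    show "\<xi> ^ i \<noteq> \<xi> ^ j"
    proof
      assume "\<xi> ^ i = \<xi> ^ j"
      then have "\<xi> ^ (j - i) = 1" using nz ij(1) by (simp add: power_diff)
      with ij show False using iff[of "j - i"] by (auto dest: dvd_imp_le)
    qed
  qed auto
  have "(\<lambda>t. \<xi> ^ t) ` {..<m} \<subseteq> {x. x ^ m = 1}"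
    by (auto simp: iff simp flip: power_mult)
  then show ?thesis
    using card_subset_eq[OF fin] le card_mono[OF fin] card_image[OF inj]
    by (metis card_lessThan le_antisym)
qed

text \<open>
  Turns the conditions on classes of scalars into equations between powers, the form in which
  automorphisms see them.
\<close>

lemma root_class_eq_iff:
  fixes a c :: "'f::{alg_closed_field, field_char_0}"
  assumes "0 < m"
  shows "root_class m a = root_class m c \<longleftrightarrow> a ^ m = c ^ m"
proof -
  define \<xi> :: 'f where "\<xi> = (SOME \<xi>. primitive_root_of_unity m \<xi>)"
  have \<xi>: "primitive_root_of_unity m \<xi>"
    unfolding \<xi>_def using exists_primitive_root_of_unity[OF assms] by (rule someI_ex)
  have cls: "root_class m d = (\<lambda>x. d * x) ` {x. x ^ m = 1}" for d :: 'f
    unfolding roots_of_unity_eq_powers[OF \<xi> assms] root_class_def Let_def \<xi>_def[symmetric]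
    by auto
  have sub: "root_class m d \<subseteq> root_class m e" if "d ^ m = e ^ m" for d e :: 'f
  proof (cases "e = 0")
    case True
    then show ?thesis using that assms by (auto simp: cls power_0_left)
  next
    case False
    then have "d * x = e * (d * x / e)" "(d * x / e) ^ m = 1" if "x ^ m = 1" for x
      using that \<open>d ^ m = e ^ m\<close> by (simp_all add: power_mult_distrib power_divide)
    then show ?thesis unfolding cls by blast
  qed
  have "a \<in> root_class m a" by (auto simp: cls intro!: image_eqI[of _ _ 1])
  then have "a ^ m = c ^ m" if "root_class m a = root_class m c"
    using that by (auto simp: cls power_mult_distrib)
  then show ?thesis using sub by (metis subset_antisym)
qed

section \<open>Bracket and automorphisms of the twisted Heisenberg algebra\<close>

lemma heis_bracket_scale_left: "heis_bracket lam (c *s x) w = c *s heis_bracket lam x w"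
  and heis_bracket_scale_right: "heis_bracket lam w (c *s x) = c *s heis_bracket lam w x"
  by (rule heis_eqI; simp add: heis_bracket_nth sum_distrib_left algebra_simps)+

lemma heis_bracket_zero: "heis_bracket lam 0 w = 0" "heis_bracket lam w 0 = 0"
  using heis_bracket_scale_left[of lam 0] heis_bracket_scale_right[of lam w 0] by simp_all

lemma heis_bracket_antisym: "heis_bracket lam x y = - heis_bracket lam y x"
  by (rule heis_eqI; simp add: heis_bracket_nth algebra_simps flip: sum_negf)

lemma span_singleton_scale:
  fixes v :: "'f::field ^ 'n::finite"
  assumes "c \<noteq> 0"
  shows "vec.span {c *s v} = vec.span {v}"
proof -
  have "k *s v = (k / c) *s (c *s v)" "k *s (c *s v) = (k * c) *s v" for k using assms by simp_all
  then show ?thesis unfolding vec.span_singleton by blast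
qed

text \<open>
  Bilinearity reduces multiplicativity to a spanning set, and in finite dimension a linear map whose
  range contains a spanning set is bijective.
\<close>

lemma algebra_automorphismI:
  fixes f :: "('f::field, 'k::finite) heis \<Rightarrow> ('f, 'k) heis"
  assumes lin: "Vector_Spaces.linear (*s) (*s) f" and span: "vec.span B = UNIV"
    and range: "vec.span B' = UNIV" "B' \<subseteq> range f"
    and hom: "\<And>v w. v \<in> B \<Longrightarrow> w \<in> B \<Longrightarrow>
      f (heis_bracket lam v w) = heis_bracket lam (f v) (f w)"
  shows "algebra_automorphism (heis_bracket lam) f"
proof -
  have f_alt: "f (c *s x + y) = c *s f x + f y" for c x y
    using lin by (simp add: vec.linear_add vec.linear_scale)
  have f0: "f 0 = 0" using lin by (rule vec.linear_0)
  have half: "f (heis_bracket lam v w) = heis_bracket lam (f v) (f w)" if "v \<in> B" for v w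
  proof -
    have "w \<in> vec.span B" using span by simp
    then show ?thesis
      by (induction rule: vec.span_induct_alt)
        (simp_all add: heis_bracket_bilinear heis_bracket_zero f_alt f0 hom that)
  qed
  have full: "f (heis_bracket lam v w) = heis_bracket lam (f v) (f w)" for v w
  proof -
    have "v \<in> vec.span B" using span by simp
    then show ?thesis
      by (induction rule: vec.span_induct_alt)
        (simp_all add: heis_bracket_bilinear heis_bracket_zero f_alt f0 half)
  qed
  have "vec.subspace (range f)"
    using lin vec.subspace_UNIV by (rule vec.linear_subspace_image)
  then have "surj f" using range vec.span_minimal by blast
  then have "bij f" using vec.linear_surj_imp_inj[OF lin] by (simp add: bij_def)
  then show ?thesis using lin full by (simp add: algebra_automorphism_def)
qed

section \<open>Bases made of blocks\<close>

text \<open>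
  The cycles of basis lines under \<open>ad u\<close>: the two halves of the \<open>j\<close>-th type I block and the whole of
  the \<open>i\<close>-th type II block. Treating them alike makes shifts and pairings uniform in the block type.
\<close>

datatype block_cycle = X_cyc nat | Y_cyc nat | W_cyc nat

datatype basis_label = Z_lab | U_lab | V_lab block_cycle nat

text \<open>The only cycle whose elements can have a nonzero bracket with those of the given one.\<close>

fun dual_cycle :: "block_cycle \<Rightarrow> block_cycle" where
  "dual_cycle (X_cyc j) = Y_cyc j"
| "dual_cycle (Y_cyc j) = X_cyc j"
| "dual_cycle (W_cyc i) = W_cyc i"

fun cycle_scalar :: "(nat \<Rightarrow> 'f) \<Rightarrow> (nat \<Rightarrow> 'f) \<Rightarrow> block_cycle \<Rightarrow> 'f" where
  "cycle_scalar \<beta> \<alpha> (X_cyc j) = \<beta> j"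
| "cycle_scalar \<beta> \<alpha> (Y_cyc j) = \<beta> j"
| "cycle_scalar \<beta> \<alpha> (W_cyc i) = \<alpha> i"

text \<open>
  The scalar by which \<open>(ad u)^l\<close> acts on a cycle is this sign times the \<open>l\<close>-th power of the scalar of
  the cycle. It enters through the last step of the cycle, which closes it up.
\<close>

fun cycle_sign :: "nat \<Rightarrow> block_cycle \<Rightarrow> 'f::field" where
  "cycle_sign l (Y_cyc j) = (-1) ^ l"
| "cycle_sign l (X_cyc j) = 1"
| "cycle_sign l (W_cyc i) = 1"

definition shift_sign :: "nat \<Rightarrow> block_cycle \<Rightarrow> nat \<Rightarrow> 'f::field" where
  "shift_sign l c i = (if i = l then cycle_sign l c else 1)"

definition next_pos :: "nat \<Rightarrow> nat \<Rightarrow> nat" where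
  "next_pos l i = Suc (i mod l)"

text \<open>
  For positions in \<open>{1..l}\<close> the divisibility says that \<open>i + i' = l\<close> or \<open>i = i' = l\<close>, which merges the
  two clauses for nonzero products in a type I block.
\<close>

fun paired :: "nat \<Rightarrow> block_cycle \<Rightarrow> nat \<Rightarrow> nat \<Rightarrow> bool" where
  "paired l (W_cyc _) i i' \<longleftrightarrow> i + i' = Suc l"
| "paired l _ i i' \<longleftrightarrow> l dvd i + i'"

fun pairing_sign :: "block_cycle \<Rightarrow> nat \<Rightarrow> nat \<Rightarrow> 'f::field" where
  "pairing_sign (X_cyc j) i i' = (-1) ^ i'"
| "pairing_sign (Y_cyc j) i i' = - ((-1) ^ i)"
| "pairing_sign (W_cyc j) i i' = (-1) ^ i"

definition cycles :: "nat \<Rightarrow> nat \<Rightarrow> block_cycle set" where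
  "cycles s r = X_cyc ` {1..s} \<union> Y_cyc ` {1..s} \<union> W_cyc ` {1..r}"

definition labels :: "nat \<Rightarrow> nat \<Rightarrow> nat \<Rightarrow> basis_label set" where
  "labels l s r = {Z_lab, U_lab} \<union> {V_lab c i |c i. c \<in> cycles s r \<and> i \<in> {1..l}}"

lemma dual_dual [simp]: "dual_cycle (dual_cycle c) = c"
  by (cases c) auto

lemma cycles_simps [simp]:
  "X_cyc j \<in> cycles s r \<longleftrightarrow> j \<in> {1..s}" "Y_cyc j \<in> cycles s r \<longleftrightarrow> j \<in> {1..s}"
  "W_cyc i \<in> cycles s r \<longleftrightarrow> i \<in> {1..r}"
  by (auto simp: cycles_def)

lemma dual_in_cycles [simp]: "dual_cycle c \<in> cycles s r \<longleftrightarrow> c \<in> cycles s r"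
  by (cases c) auto

lemma finite_cycles [simp]: "finite (cycles s r)"
  by (simp add: cycles_def)

lemma card_cycles: "card (cycles s r) = 2 * s + r"
  unfolding cycles_def
  by (subst card_Un_disjoint; (subst card_Un_disjoint)?) (auto simp: card_image inj_on_def)

lemma labels_simps [simp]:
  "Z_lab \<in> labels l s r" "U_lab \<in> labels l s r"
  "V_lab c i \<in> labels l s r \<longleftrightarrow> c \<in> cycles s r \<and> i \<in> {1..l}"
  by (auto simp: labels_def)

lemma labels_altdef:
  "labels l s r = insert Z_lab (insert U_lab (case_prod V_lab ` (cycles s r \<times> {1..l})))"
  by (auto simp: labels_def)

lemma finite_labels [simp]: "finite (labels l s r)"
  by (simp add: labels_altdef)

lemma card_labels: "card (labels l s r) = 2 + l * (r + 2 * s)"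
proof -
  have "card (case_prod V_lab ` (cycles s r \<times> {1..l})) = card (cycles s r \<times> {1..l})"
    by (rule card_image) (auto simp: inj_on_def)
  then show ?thesis unfolding labels_altdef
    by (subst card_insert_disjoint; auto simp: card_cycles card_cartesian_product algebra_simps)+
qed

lemma next_pos_mem: "0 < l \<Longrightarrow> next_pos l i \<in> {1..l}"
  by (simp add: next_pos_def Suc_leI)

lemma next_pos_less: "i < l \<Longrightarrow> next_pos l i = Suc i"
  by (simp add: next_pos_def)

lemma next_pos_self: "next_pos l l = 1"
  by (simp add: next_pos_def)

text \<open>
  Linear independence is imposed once, on the whole family; with injectivity of the family it contains
  the independence of each block and the disjointness of different blocks.
\<close>

locale block_basis =
  fixes lam :: "'f::field ^ 'k::finite" and l s r :: nat and \<beta> \<alpha> :: "nat \<Rightarrow> 'f"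
    and b :: "basis_label \<Rightarrow> ('f, 'k) heis"
  assumes l_pos: "0 < l" and some_cycle: "cycles s r \<noteq> {}"
    and scalar_nonzero: "c \<in> cycles s r \<Longrightarrow> cycle_scalar \<beta> \<alpha> c \<noteq> 0"
    and central: "heis_bracket lam (b Z_lab) v = 0"
    and shift: "c \<in> cycles s r \<Longrightarrow> i \<in> {1..l} \<Longrightarrow>
      heis_bracket lam (b U_lab) (b (V_lab c i)) =
        (shift_sign l c i * cycle_scalar \<beta> \<alpha> c) *s b (V_lab c (next_pos l i))"
    and pairing: "c \<in> cycles s r \<Longrightarrow> c' \<in> cycles s r \<Longrightarrow> i \<in> {1..l} \<Longrightarrow> i' \<in> {1..l} \<Longrightarrow>
      heis_bracket lam (b (V_lab c i)) (b (V_lab c' i')) =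
        (if c' = dual_cycle c \<and> paired l c i i'
         then (pairing_sign c i i' * cycle_scalar \<beta> \<alpha> c) *s b Z_lab else 0)"
    and inj: "inj_on b (labels l s r)"
    and independent: "vec.independent (b ` labels l s r)"
    and span: "vec.span (b ` labels l s r) = UNIV"
begin

lemma basis_nonzero: "p \<in> labels l s r \<Longrightarrow> b p \<noteq> 0"
  using independent vec.dependent_zero by (metis imageI)

lemma proportional_imp_eq:
  assumes "p \<in> labels l s r" "q \<in> labels l s r" "k *s b p = k' *s b q" "k \<noteq> 0"
  shows "p = q"
proof (rule ccontr)
  assume "p \<noteq> q"
  then have "b q \<in> b ` labels l s r - {b p}" using assms inj by (auto dest: inj_onD)
  moreover have "b p = (k' / k) *s b q"
    using arg_cong[OF assms(3), of "\<lambda>v. inverse k *s v"] assms(4)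
    by (simp add: vec.scale_scale field_simps)
  ultimately have "b p \<in> vec.span (b ` labels l s r - {b p})"
    by (metis vec.span_base vec.span_scale)
  then show False using independent assms(1) by (auto simp: vec.dependent_def)
qed

lemma central_right: "heis_bracket lam v (b Z_lab) = 0"
  using heis_bracket_antisym[of lam v] by (simp add: central)

definition grading :: "('f, 'k) heis set set" where
  "grading = (\<lambda>p. vec.span {b p}) ` labels l s r"

lemma ex_linear_extension:
  "\<exists>f. Vector_Spaces.linear (*s) (*s) f \<and> (\<forall>p\<in>labels l s r. f (b p) = (h p :: ('f, 'k) heis))"
proof -
  have "\<exists>f. Vector_Spaces.linear (*s) (*s) f \<and>
      (\<forall>v\<in>b ` labels l s r. f v = h (inv_into (labels l s r) b v))"
    using independent by (rule vec.linear_independent_extend)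
  then show ?thesis using inj by simp
qed

end

text \<open>
  A linear map that relabels cycles by \<open>\<tau>\<close> and rescales the basis vectors by \<open>h\<close>, and \<open>z\<close>, \<open>u\<close> by
  \<open>\<epsilon>\<close>, is an automorphism as soon as the brackets \<open>[u, v]\<close> and \<open>[v, v']\<close> of basis vectors are
  compatible; the two equations on \<open>h\<close> express exactly this. Scaling \<open>z\<close> and \<open>u\<close> by the same factor
  keeps square roots out of the constants that type II blocks need.
\<close>

lemma equivalent_gradingsI_rescaled_relabelling:
  assumes "block_basis lam l s r \<beta> \<alpha> b" "block_basis lam l s r \<beta>' \<alpha>' b'"
    and \<tau>: "bij_betw \<tau> (cycles s r) (cycles s r)"
    and \<tau>_dual: "\<And>c. c \<in> cycles s r \<Longrightarrow> \<tau> (dual_cycle c) = dual_cycle (\<tau> c)"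
    and \<tau>_paired: "\<And>c i i'. paired l (\<tau> c) i i' = paired l c i i'"
    and \<epsilon>: "\<epsilon> \<noteq> 0"
    and h: "\<And>c i. c \<in> cycles s r \<Longrightarrow> i \<in> {1..l} \<Longrightarrow> h c i \<noteq> 0"
    and h_shift: "\<And>c i. c \<in> cycles s r \<Longrightarrow> i \<in> {1..l} \<Longrightarrow>
      \<epsilon> * h c i * (shift_sign l (\<tau> c) i * cycle_scalar \<beta>' \<alpha>' (\<tau> c)) =
        shift_sign l c i * cycle_scalar \<beta> \<alpha> c * h c (next_pos l i)"
    and h_pairing: "\<And>c i i'. c \<in> cycles s r \<Longrightarrow> i \<in> {1..l} \<Longrightarrow> i' \<in> {1..l} \<Longrightarrow> paired l c i i' \<Longrightarrow>
      h c i * h (dual_cycle c) i' * (pairing_sign (\<tau> c) i i' * cycle_scalar \<beta>' \<alpha>' (\<tau> c)) =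
        \<epsilon> * (pairing_sign c i i' * cycle_scalar \<beta> \<alpha> c)"
  shows "equivalent_gradings (heis_bracket lam)
    (block_basis.grading l s r b) (block_basis.grading l s r b')"
proof -
  interpret B: block_basis lam l s r \<beta> \<alpha> b by fact
  interpret B': block_basis lam l s r \<beta>' \<alpha>' b' by fact
  define \<pi> where "\<pi> p = (case p of V_lab c i \<Rightarrow> V_lab (\<tau> c) i | p \<Rightarrow> p)" for p
  define g where "g p = (case p of V_lab c i \<Rightarrow> h c i | _ \<Rightarrow> \<epsilon>)" for p
  have \<tau>_mem: "\<tau> c \<in> cycles s r" if "c \<in> cycles s r" for c using \<tau> that by (auto simp: bij_betw_def)
  have \<tau>_eq: "\<tau> c = \<tau> d \<longleftrightarrow> c = d" if "c \<in> cycles s r" "d \<in> cycles s r" for c d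
    using \<tau> that by (auto simp: bij_betw_def dest: inj_onD)
  have \<pi>_image: "\<pi> ` labels l s r = labels l s r"
  proof -
    have "V_lab d i \<in> \<pi> ` labels l s r" if di: "d \<in> cycles s r" "i \<in> {1..l}" for d i
    proof -
      obtain c where "c \<in> cycles s r" "d = \<tau> c" using \<tau> di(1) by (auto simp: bij_betw_def)
      then show ?thesis using di(2) by (intro image_eqI[of _ _ "V_lab c i"]) (auto simp: \<pi>_def)
    qed
    moreover have "Z_lab \<in> \<pi> ` labels l s r" "U_lab \<in> \<pi> ` labels l s r"
      by (force simp: \<pi>_def intro: image_eqI[of _ _ Z_lab] image_eqI[of _ _ U_lab])+
    ultimately show ?thesis using \<tau>_mem by (auto simp: labels_def \<pi>_def)
  qed
  have g: "g p \<noteq> 0" if "p \<in> labels l s r" for p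
    using that \<epsilon> h by (cases p) (auto simp: g_def)
  obtain f where lin: "Vector_Spaces.linear (*s) (*s) f"
    and f: "\<And>p. p \<in> labels l s r \<Longrightarrow> f (b p) = g p *s b' (\<pi> p)"
    using B.ex_linear_extension[of "\<lambda>p. g p *s b' (\<pi> p)"] by blast
  have f0: "f 0 = 0" and f_scale: "\<And>c x. f (c *s x) = c *s f x" and f_neg: "\<And>x. f (- x) = - f x"
    using lin by (simp_all add: vec.linear_0 vec.linear_scale vec.linear_neg)
  have fZ: "f (b Z_lab) = \<epsilon> *s b' Z_lab" and fU: "f (b U_lab) = \<epsilon> *s b' U_lab"
    using f[of Z_lab] f[of U_lab] by (simp_all add: \<pi>_def g_def)
  have fV: "f (b (V_lab c i)) = h c i *s b' (V_lab (\<tau> c) i)"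
    if "c \<in> cycles s r" "i \<in> {1..l}" for c i
    using f[of "V_lab c i"] that by (simp add: \<pi>_def g_def)
  note bracket_simps = heis_bracket_scale_left heis_bracket_scale_right heis_bracket_zero
    heis_bracket_self f0 f_scale vec.scale_scale
  have hom_UV: "f (heis_bracket lam (b U_lab) (b (V_lab c i))) =
      heis_bracket lam (f (b U_lab)) (f (b (V_lab c i)))"
    if "c \<in> cycles s r" "i \<in> {1..l}" for c i
    using that h_shift[OF that] next_pos_mem[OF B.l_pos]
    by (simp add: B.shift B'.shift fU fV \<tau>_mem bracket_simps mult.assoc mult.commute mult.left_commute del: atLeastAtMost_iff)
  have hom_VV: "f (heis_bracket lam (b (V_lab c i)) (b (V_lab d j))) =
      heis_bracket lam (f (b (V_lab c i))) (f (b (V_lab d j)))"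
    if "c \<in> cycles s r" "i \<in> {1..l}" "d \<in> cycles s r" "j \<in> {1..l}" for c i d j
  proof (cases "d = dual_cycle c \<and> paired l c i j")
    case True
    then show ?thesis using that h_pairing[of c i j]
      by (simp add: B.pairing B'.pairing fZ fV \<tau>_mem \<tau>_dual \<tau>_paired bracket_simps
          mult.assoc mult.commute mult.left_commute del: atLeastAtMost_iff)
  next
    case False
    have "\<tau> d = dual_cycle (\<tau> c) \<longleftrightarrow> d = dual_cycle c"
      using that \<tau>_eq[of d "dual_cycle c"] \<tau>_dual[of c] by simp
    then show ?thesis using False that
      by (auto simp: B.pairing B'.pairing fV \<tau>_mem \<tau>_paired bracket_simps simp del: atLeastAtMost_iff)
  qed
  have hom: "f (heis_bracket lam (b p) (b q)) = heis_bracket lam (f (b p)) (f (b q))"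
    if "p \<in> labels l s r" "q \<in> labels l s r" for p q
  proof -
    have flip: "f (heis_bracket lam x y) = heis_bracket lam (f x) (f y)"
      if "f (heis_bracket lam y x) = heis_bracket lam (f y) (f x)" for x y
      using that heis_bracket_antisym[of lam x y] heis_bracket_antisym[of lam "f x" "f y"]
      by (simp add: f_neg)
    show ?thesis using that hom_UV hom_VV
      by (cases p; cases q)
        (simp_all add: fZ B.central B'.central B.central_right B'.central_right bracket_simps flip)
  qed
  have "algebra_automorphism (heis_bracket lam) f"
  proof (rule algebra_automorphismI[OF lin B.span B'.span])
    show "b' ` labels l s r \<subseteq> range f"
    proof
      fix v assume "v \<in> b' ` labels l s r"
      then obtain p where p: "p \<in> labels l s r" "v = b' (\<pi> p)" using \<pi>_image by (metis imageE)
      then have "v = f (inverse (g p) *s b p)" using g by (simp add: f f_scale vec.scale_scale)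
      then show "v \<in> range f" by blast
    qed
  qed (use hom in auto)
  moreover from this have "inj f" by (simp add: algebra_automorphism_def bij_def)
  then have "inj_on (\<lambda>V. f ` V) A" for A by (auto simp: inj_on_def inj_image_eq_iff)
  moreover have "f ` vec.span {b p} = vec.span {b' (\<pi> p)}" if "p \<in> labels l s r" for p
    using vec.linear_span_image[OF lin, of "{b p}"] f[OF that]
    by (simp add: span_singleton_scale g that)
  then have "(\<lambda>V. f ` V) ` B.grading = (\<lambda>q. vec.span {b' q}) ` \<pi> ` labels l s r"
    unfolding B.grading_def image_image by (rule image_cong[OF refl])
  then have "(\<lambda>V. f ` V) ` B.grading = B'.grading" unfolding B'.grading_def \<pi>_image .
  ultimately show ?thesis unfolding equivalent_gradings_def bij_betw_def by blast
qed

lemma dvd_add_iff_complement: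
  fixes i i' l :: nat
  assumes "i \<in> {1..l}" "i' \<in> {1..l}"
  shows "l dvd i + i' \<longleftrightarrow> i + i' = l \<or> i = l \<and> i' = l"
proof
  assume "l dvd i + i'"
  then obtain k where k: "i + i' = l * k" by (elim dvdE)
  have "k \<noteq> 0" using k assms by (intro notI) auto
  have "l * k \<le> l * 2" unfolding k[symmetric] using assms by simp
  then have "k \<le> 2" using assms by simp
  then have "k = 1 \<or> k = 2" using \<open>k \<noteq> 0\<close> by linarith
  then show "i + i' = l \<or> i = l \<and> i' = l" using k assms by auto
qed auto

lemma block_I_shift:
  assumes "block_I br z u \<beta> l x y" "i \<in> {1..l}"
  shows "br u (x i) = \<beta> *s x (next_pos l i)"
    and "br u (y i) = ((if i = l then (-1) ^ l else 1) * \<beta>) *s y (next_pos l i)"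
  using assms by (cases "i = l"; simp add: block_I_def next_pos_def)+

lemma block_I_pairing:
  assumes "block_I br z u \<beta> l x y" "i \<in> {1..l}" "i' \<in> {1..l}"
  shows "br (x i) (y i') = (if l dvd i + i' then ((-1) ^ i' * \<beta>) *s z else 0)"
    and "br (x i) (x i') = 0" "br (y i) (y i') = 0"
proof -
  consider (lt) "i + i' = l" | (eq) "i = l" "i' = l" | (no) "i + i' \<noteq> l" "\<not> (i = l \<and> i' = l)"
    by blast
  then show "br (x i) (y i') = (if l dvd i + i' then ((-1) ^ i' * \<beta>) *s z else 0)"
  proof cases
    case lt
    then have "i' = l - i" "i \<in> {1..<l}" using assms by auto
    with lt assms(1) show ?thesis by (auto simp: block_I_def)
  next
    case eq
    then show ?thesis using assms(1) by (simp add: block_I_def)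
  next
    case no
    then show ?thesis using assms by (simp only: dvd_add_iff_complement block_I_def) simp
  qed
qed (use assms in \<open>simp_all add: block_I_def\<close>)

lemma block_II_pairing:
  assumes "block_II br z u \<alpha> l x" "i \<in> {1..2 * l}" "i' \<in> {1..2 * l}"
  shows "br (x i) (x i') = (if i + i' = Suc (2 * l) then ((-1) ^ i * \<alpha>) *s z else 0)"
proof -
  have "i' = 2 * l - i + 1 \<longleftrightarrow> i + i' = Suc (2 * l)" using assms(2,3) by auto
  then show ?thesis using assms by (auto simp: block_II_def)
qed

text \<open>
  The basis of a block grading is only given as a set. That its vectors are pairwise distinct as a
  labelled family follows by counting: there are \<open>l (r + 2 s) + 2 = 2 k + 2\<close> labels, as many as the
  dimension.
\<close>

lemma block_grading_has_block_basis:
  fixes lam :: "'f::field ^ 'k::finite"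
  assumes lam: "\<forall>i. lam $ i \<noteq> 0" and "is_block_grading lam l s r \<beta> \<alpha> \<Gamma>"
  obtains b where "block_basis lam l s r \<beta> \<alpha> b" "\<Gamma> = block_basis.grading l s r b"
proof -
  note G = assms(2)[unfolded is_block_grading_def Let_def]
  from G have l: "0 < l" and rank: "l * (r + 2 * s) = 2 * CARD('k)" and even: "r \<noteq> 0 \<longrightarrow> even l"
    and \<beta>: "\<forall>j\<in>{1..s}. \<exists>m. \<beta> j = lam $ m \<or> \<beta> j = - (lam $ m)"
    and \<alpha>: "\<forall>i\<in>{1..r}. \<exists>m. \<alpha> i = lam $ m \<or> \<alpha> i = - (lam $ m)"
    by (simp_all add: Suc_le_eq)
  from G obtain z u x y w where
    central: "\<forall>v. heis_bracket lam z v = 0" and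
    I: "\<forall>j\<in>{1..s}. block_I (heis_bracket lam) z u (\<beta> j) l (x j) (y j)" and
    II: "\<forall>i\<in>{1..r}. block_II (heis_bracket lam) z u (\<alpha> i) (l div 2) (w i)" and
    XX: "\<forall>j\<in>{1..s}. \<forall>j'\<in>{1..s}. j \<noteq> j' \<longrightarrow> (\<forall>v\<in>x j ` {1..l} \<union> y j ` {1..l}.
      \<forall>v'\<in>x j' ` {1..l} \<union> y j' ` {1..l}. heis_bracket lam v v' = 0)" and
    WW: "\<forall>i\<in>{1..r}. \<forall>i'\<in>{1..r}. i \<noteq> i' \<longrightarrow>
      (\<forall>v\<in>w i ` {1..l}. \<forall>v'\<in>w i' ` {1..l}. heis_bracket lam v v' = 0)" and
    XW: "\<forall>j\<in>{1..s}. \<forall>i\<in>{1..r}. \<forall>v\<in>x j ` {1..l} \<union> y j ` {1..l}.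
      \<forall>v'\<in>w i ` {1..l}. heis_bracket lam v v' = 0" and
    indep: "vec.independent ({z, u} \<union> (\<Union>j\<in>{1..s}. x j ` {1..l} \<union> y j ` {1..l}) \<union>
      (\<Union>i\<in>{1..r}. w i ` {1..l}))" and
    span: "vec.span ({z, u} \<union> (\<Union>j\<in>{1..s}. x j ` {1..l} \<union> y j ` {1..l}) \<union>
      (\<Union>i\<in>{1..r}. w i ` {1..l})) = UNIV" and
    \<Gamma>: "\<Gamma> = (\<lambda>v. vec.span {v}) ` ({z, u} \<union> (\<Union>j\<in>{1..s}. x j ` {1..l} \<union> y j ` {1..l}) \<union>
      (\<Union>i\<in>{1..r}. w i ` {1..l}))"
    by (elim conjE exE) (rule that)
  define b where "b p = (case p of Z_lab \<Rightarrow> z | U_lab \<Rightarrow> u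
      | V_lab c i \<Rightarrow> (case c of X_cyc j \<Rightarrow> x j i | Y_cyc j \<Rightarrow> y j i | W_cyc m \<Rightarrow> w m i))" for p
  have b [simp]: "b Z_lab = z" "b U_lab = u" "b (V_lab (X_cyc j) i) = x j i"
    "b (V_lab (Y_cyc j) i) = y j i" "b (V_lab (W_cyc j) i) = w j i" for i j
    by (simp_all add: b_def)
  have V_image: "{b (V_lab c i) |c i. c \<in> cycles s r \<and> i \<in> {1..l}} =
      (\<Union>j\<in>{1..s}. x j ` {1..l} \<union> y j ` {1..l}) \<union> (\<Union>i\<in>{1..r}. w i ` {1..l})"
  proof (intro subset_antisym subsetI)
    fix v assume "v \<in> {b (V_lab c i) |c i. c \<in> cycles s r \<and> i \<in> {1..l}}"
    then obtain c i where "v = b (V_lab c i)" "c \<in> cycles s r" "i \<in> {1..l}" by blast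
    then show "v \<in> (\<Union>j\<in>{1..s}. x j ` {1..l} \<union> y j ` {1..l}) \<union> (\<Union>i\<in>{1..r}. w i ` {1..l})"
      by (cases c; simp del: atLeastAtMost_iff; blast)
  next
    fix v assume "v \<in> (\<Union>j\<in>{1..s}. x j ` {1..l} \<union> y j ` {1..l}) \<union> (\<Union>i\<in>{1..r}. w i ` {1..l})"
    then consider j i where "v = b (V_lab (X_cyc j) i)" "j \<in> {1..s}" "i \<in> {1..l}"
      | j i where "v = b (V_lab (Y_cyc j) i)" "j \<in> {1..s}" "i \<in> {1..l}"
      | j i where "v = b (V_lab (W_cyc j) i)" "j \<in> {1..r}" "i \<in> {1..l}" by auto
    then show "v \<in> {b (V_lab c i) |c i. c \<in> cycles s r \<and> i \<in> {1..l}}"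
      by cases (metis (mono_tags, lifting) CollectI cycles_simps)+
  qed
  have "b ` labels l s r = {z, u} \<union> {b (V_lab c i) |c i. c \<in> cycles s r \<and> i \<in> {1..l}}"
    unfolding labels_def image_Un by auto
  then have image: "b ` labels l s r = {z, u} \<union> (\<Union>j\<in>{1..s}. x j ` {1..l} \<union> y j ` {1..l}) \<union>
      (\<Union>i\<in>{1..r}. w i ` {1..l})"
    unfolding V_image by (simp only: Un_assoc)
  have "card (b ` labels l s r) = vec.dim (UNIV :: ('f, 'k) heis set)"
    using indep span unfolding image[symmetric] by (intro vec.basis_card_eq_dim) auto
  also have "\<dots> = card (labels l s r)"
    unfolding vec_dim_card by (simp add: card_heis_index card_labels rank)
  finally have inj: "inj_on b (labels l s r)" by (intro eq_card_imp_inj_on) simp_all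
  have II_len: "2 * (l div 2) = l" if "m \<in> {1..r}" for m using that even by auto
  have shift: "heis_bracket lam (b U_lab) (b (V_lab c i)) =
      (shift_sign l c i * cycle_scalar \<beta> \<alpha> c) *s b (V_lab c (next_pos l i))"
    if "c \<in> cycles s r" "i \<in> {1..l}" for c i
  proof (cases c)
    case (W_cyc m)
    then have m: "m \<in> {1..r}" using that by simp
    then have "block_II (heis_bracket lam) z u (\<alpha> m) (l div 2) (w m)" using II by blast
    then show ?thesis using W_cyc that(2) unfolding block_II_def II_len[OF m]
      by (simp add: next_pos_def shift_sign_def)
  qed (use that block_I_shift[OF bspec[OF I]] in \<open>auto simp: shift_sign_def\<close>)
  have pairing: "heis_bracket lam (b (V_lab c i)) (b (V_lab c' i')) =
      (if c' = dual_cycle c \<and> paired l c i i'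
       then (pairing_sign c i i' * cycle_scalar \<beta> \<alpha> c) *s b Z_lab else 0)"
    if c: "c \<in> cycles s r" "c' \<in> cycles s r" and i: "i \<in> {1..l}" "i' \<in> {1..l}" for c c' i i'
  proof -
    note same = block_I_pairing[OF bspec[OF I] i]
    have other: "heis_bracket lam v v' = 0" if "j \<in> {1..s}" "j' \<in> {1..s}" "j \<noteq> j'"
      "v \<in> {x j i, y j i}" "v' \<in> {x j' i', y j' i'}" for j j' v v'
    proof -
      have "v \<in> x j ` {1..l} \<union> y j ` {1..l}" "v' \<in> x j' ` {1..l} \<union> y j' ` {1..l}"
        using that i by auto
      then show ?thesis using XX that by blast
    qed
    have xx: "heis_bracket lam (x j i) (x j' i') = 0" and yy: "heis_bracket lam (y j i) (y j' i') = 0"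
      and xy: "heis_bracket lam (x j i) (y j' i') =
        (if j = j' \<and> l dvd i + i' then ((-1) ^ i' * \<beta> j) *s z else 0)"
      and yx: "heis_bracket lam (y j i) (x j' i') =
        (if j = j' \<and> l dvd i + i' then (- ((-1) ^ i) * \<beta> j) *s z else 0)"
      if "j \<in> {1..s}" "j' \<in> {1..s}" for j j'
      using same[OF that(1)] other[OF that] block_I_pairing(1)[OF bspec[OF I that(1)] i(2,1)]
        heis_bracket_antisym[of lam "y j i" "x j i'"]
      by (cases "j = j'"; simp add: add.commute)+
    have xw: "heis_bracket lam (x j i) (w m i') = 0" and yw: "heis_bracket lam (y j i) (w m i') = 0"
      and wx: "heis_bracket lam (w m i) (x j i') = 0" and wy: "heis_bracket lam (w m i) (y j i') = 0"
      if "j \<in> {1..s}" "m \<in> {1..r}" for j m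
    proof -
      have *: "heis_bracket lam v (w m p) = 0" if "p \<in> {i, i'}" "v \<in> {x j i, y j i, x j i', y j i'}" for p v
      proof -
        have "v \<in> x j ` {1..l} \<union> y j ` {1..l}" "w m p \<in> w m ` {1..l}" using that i by auto
        then show ?thesis using XW \<open>j \<in> {1..s}\<close> \<open>m \<in> {1..r}\<close> by blast
      qed
      then show "heis_bracket lam (x j i) (w m i') = 0" "heis_bracket lam (y j i) (w m i') = 0"
        "heis_bracket lam (w m i) (x j i') = 0" "heis_bracket lam (w m i) (y j i') = 0"
        using heis_bracket_antisym[of lam "w m i" "x j i'"] heis_bracket_antisym[of lam "w m i" "y j i'"]
        by simp_all
    qed
    have ww: "heis_bracket lam (w m i) (w m' i') =
        (if m = m' \<and> i + i' = Suc l then ((-1) ^ i * \<alpha> m) *s z else 0)"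
      if m: "m \<in> {1..r}" "m' \<in> {1..r}" for m m'
    proof (cases "m = m'")
      case True
      then show ?thesis
        using block_II_pairing[OF bspec[OF II m(1)], unfolded II_len[OF m(1)], OF i] by simp
    next
      case False
      then have "heis_bracket lam (w m i) (w m' i') = 0" using WW m i by blast
      then show ?thesis using False by simp
    qed
    show ?thesis
      using c by (cases c; cases c'; simp add: xx xy yx yy xw yw wx wy ww del: atLeastAtMost_iff; blast)
  qed
  have basis: "block_basis lam l s r \<beta> \<alpha> b"
  proof
    have "r + 2 * s \<noteq> 0" using rank by (intro notI) simp
    then show "cycles s r \<noteq> {}" by (auto simp: cycles_def)
    have \<beta>_nz: "\<beta> j \<noteq> 0" if "j \<in> {1..s}" for j
      using bspec[OF \<beta> that] lam by (metis neg_equal_0_iff_equal)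
    have \<alpha>_nz: "\<alpha> i \<noteq> 0" if "i \<in> {1..r}" for i
      using bspec[OF \<alpha> that] lam by (metis neg_equal_0_iff_equal)
    show "cycle_scalar \<beta> \<alpha> c \<noteq> 0" if "c \<in> cycles s r" for c
      using that \<beta>_nz \<alpha>_nz by (cases c) simp_all
  qed (use l central shift pairing inj indep span in \<open>simp_all add: image\<close>)
  have "\<Gamma> = block_basis.grading l s r b"
    unfolding block_basis.grading_def[OF basis] \<Gamma> image[symmetric] by (simp only: image_image)
  with basis show thesis by (rule that)
qed

section \<open>Matching scalars give an equivalence\<close>

text \<open>
  With \<open>q = \<epsilon> \<gamma>'/\<gamma>\<close> for scalars \<open>\<gamma>\<close> and \<open>\<gamma>'\<close> of corresponding cycles, the factors \<open>q^i\<close> make the shift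
  by \<open>ad u\<close> compatible inside a cycle. Closing up the cycle requires \<open>q^l = 1\<close>, or \<open>q^l = -1\<close> when
  the two halves of a type I block are swapped, which changes the closing sign for odd \<open>l\<close>.
\<close>

lemma equivalent_gradings_if_scalars_match:
  fixes lam :: "'f::field ^ 'k::finite"
  assumes "block_basis lam l s r \<beta> \<alpha> b" "block_basis lam l s r \<beta>' \<alpha>' b'"
    and \<epsilon>: "\<epsilon> \<noteq> 0" and \<eta>: "\<eta> permutes {1..s}" and \<sigma>: "\<sigma> permutes {1..r}"
    and \<beta>_pow: "\<And>j. j \<in> {1..s} \<Longrightarrow>
      (\<epsilon> * \<beta>' (\<eta> j)) ^ l = \<beta> j ^ l \<or> odd l \<and> (\<epsilon> * \<beta>' (\<eta> j)) ^ l = - (\<beta> j ^ l)"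
    and \<alpha>_pow: "\<And>i. i \<in> {1..r} \<Longrightarrow> (\<epsilon> * \<alpha>' (\<sigma> i)) ^ l = \<alpha> i ^ l"
  shows "equivalent_gradings (heis_bracket lam)
    (block_basis.grading l s r b) (block_basis.grading l s r b')"
proof -
  interpret B: block_basis lam l s r \<beta> \<alpha> b by fact
  interpret B': block_basis lam l s r \<beta>' \<alpha>' b' by fact
  \<comment> \<open>The type I blocks whose halves must be swapped; for these \<open>q ^ l = -1\<close>, otherwise \<open>q ^ l = 1\<close>.\<close>
  define S where "S j \<longleftrightarrow> (\<epsilon> * \<beta>' (\<eta> j)) ^ l \<noteq> \<beta> j ^ l" for j
  define \<tau> where "\<tau> c = (case c of
      X_cyc j \<Rightarrow> if S j then Y_cyc (\<eta> j) else X_cyc (\<eta> j)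
    | Y_cyc j \<Rightarrow> if S j then X_cyc (\<eta> j) else Y_cyc (\<eta> j)
    | W_cyc i \<Rightarrow> W_cyc (\<sigma> i))" for c
  define \<delta> :: "nat \<Rightarrow> 'f" where "\<delta> j = (if S j then -1 else 1)" for j
  define q where "q c = \<epsilon> * cycle_scalar \<beta>' \<alpha>' (\<tau> c) / cycle_scalar \<beta> \<alpha> c" for c
  \<comment> \<open>The constants are dictated by the pairing with \<open>z\<close> sent to \<open>\<epsilon> z'\<close>: for a type I block only the
    product over the two halves matters, with a sign from antisymmetry if they are swapped. For a
    type II block the constant must have square \<open>\<epsilon> \<alpha> / (\<alpha>' q)\<close>, and \<open>\<epsilon>\<close> cancels against \<open>q\<close>.\<close>
  define a where "a c = (case c of X_cyc j \<Rightarrow> 1 | Y_cyc j \<Rightarrow> \<delta> j * \<epsilon> * \<beta> j / \<beta>' (\<eta> j)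
    | W_cyc i \<Rightarrow> \<alpha> i / \<alpha>' (\<sigma> i))" for c
  have \<tau> [simp]: "\<tau> (X_cyc j) = (if S j then Y_cyc (\<eta> j) else X_cyc (\<eta> j))"
      "\<tau> (Y_cyc j) = (if S j then X_cyc (\<eta> j) else Y_cyc (\<eta> j))" "\<tau> (W_cyc i) = W_cyc (\<sigma> i)" for i j
    by (simp_all add: \<tau>_def)
  have a [simp]: "a (X_cyc j) = 1" "a (Y_cyc j) = \<delta> j * \<epsilon> * \<beta> j / \<beta>' (\<eta> j)"
      "a (W_cyc i) = \<alpha> i / \<alpha>' (\<sigma> i)" for i j
    by (simp_all add: a_def)
  have q [simp]: "q (X_cyc j) = \<epsilon> * \<beta>' (\<eta> j) / \<beta> j" "q (Y_cyc j) = \<epsilon> * \<beta>' (\<eta> j) / \<beta> j"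
      "q (W_cyc i) = \<epsilon> * \<alpha>' (\<sigma> i) / \<alpha> i" for i j
    by (simp_all add: q_def)
  have \<eta>_mem: "\<eta> j \<in> {1..s} \<longleftrightarrow> j \<in> {1..s}" and \<sigma>_mem: "\<sigma> i \<in> {1..r} \<longleftrightarrow> i \<in> {1..r}" for i j
    using \<eta> \<sigma> permutes_in_image by metis+
  have nz: "\<beta> j \<noteq> 0" "\<beta>' (\<eta> j) \<noteq> 0" if "j \<in> {1..s}" for j
    using that B.scalar_nonzero[of "X_cyc j"] B'.scalar_nonzero[of "X_cyc (\<eta> j)"] \<eta>_mem by auto
  have nz': "\<alpha> i \<noteq> 0" "\<alpha>' (\<sigma> i) \<noteq> 0" if "i \<in> {1..r}" for i
    using that B.scalar_nonzero[of "W_cyc i"] B'.scalar_nonzero[of "W_cyc (\<sigma> i)"] \<sigma>_mem by auto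
  have odd: "odd l" and pow_neg: "(\<epsilon> * \<beta>' (\<eta> j)) ^ l = - (\<beta> j ^ l)" if "j \<in> {1..s}" "S j" for j
    using \<beta>_pow[OF that(1)] that(2) by (auto simp: S_def)
  have q_pow: "(\<epsilon> * \<beta>' (\<eta> j) / \<beta> j) ^ l = \<delta> j" "\<delta> j ^ l = \<delta> j" if "j \<in> {1..s}" for j
    using pow_neg[OF that] odd[OF that] nz[OF that]
    by (auto simp: \<delta>_def S_def power_divide)
  have q_pow_W: "(\<epsilon> * \<alpha>' (\<sigma> i) / \<alpha> i) ^ l = 1" if "i \<in> {1..r}" for i
    using \<alpha>_pow[OF that] nz'[OF that] by (simp add: power_divide)
  have sign: "q c ^ l * cycle_sign l (\<tau> c) = cycle_sign l c" if "c \<in> cycles s r" for c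
    using that odd q_pow q_pow_W by (cases c) (auto simp: \<delta>_def split: if_splits)
  have \<tau>_mem: "\<tau> c \<in> cycles s r \<longleftrightarrow> c \<in> cycles s r" for c
    using \<eta>_mem \<sigma>_mem by (cases c) (simp_all del: atLeastAtMost_iff)
  have "inj \<tau>"
    using permutes_inj[OF \<eta>] permutes_inj[OF \<sigma>]
    by (intro injI, rename_tac c d, case_tac c; case_tac d) (auto dest: injD split: if_splits)
  then have bij: "bij_betw \<tau> (cycles s r) (cycles s r)"
    unfolding bij_betw_def using \<tau>_mem endo_inj_surj[OF finite_cycles, of \<tau>]
    by (meson image_subsetI inj_on_subset subset_UNIV)
  show ?thesis
  proof (rule equivalent_gradingsI_rescaled_relabelling[OF assms(1,2) bij _ _ \<epsilon>,
        of "\<lambda>c i. a c * q c ^ i"])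
    fix c assume c: "c \<in> cycles s r"
    show "\<tau> (dual_cycle c) = dual_cycle (\<tau> c)" by (cases c) auto
    have q_ne: "q c \<noteq> 0" using c nz nz' \<epsilon> by (cases c) auto
    show "a c * q c ^ i \<noteq> 0" for i
      using c nz nz' \<epsilon> q_ne by (cases c) (auto simp: \<delta>_def)
    fix i assume i: "i \<in> {1..l}"
    have "\<epsilon> * (a c * q c ^ i) * (shift_sign l (\<tau> c) i * cycle_scalar \<beta>' \<alpha>' (\<tau> c)) =
        a c * (q c ^ i * shift_sign l (\<tau> c) i) * (\<epsilon> * cycle_scalar \<beta>' \<alpha>' (\<tau> c))"
      by (simp only: mult_ac)
    also have "\<epsilon> * cycle_scalar \<beta>' \<alpha>' (\<tau> c) = q c * cycle_scalar \<beta> \<alpha> c"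
      using B.scalar_nonzero[OF c] by (simp add: q_def)
    also have "a c * (q c ^ i * shift_sign l (\<tau> c) i) * (q c * cycle_scalar \<beta> \<alpha> c) =
        a c * cycle_scalar \<beta> \<alpha> c * (q c * (q c ^ i * shift_sign l (\<tau> c) i))"
      by (simp only: mult_ac)
    also have "q c * (q c ^ i * shift_sign l (\<tau> c) i) = shift_sign l c i * q c ^ next_pos l i"
    proof (cases "i = l")
      case True
      then show ?thesis using sign[OF c] by (simp add: shift_sign_def next_pos_def)
    next
      case False
      then show ?thesis using i by (simp add: shift_sign_def next_pos_def)
    qed
    also have "a c * cycle_scalar \<beta> \<alpha> c * (shift_sign l c i * q c ^ next_pos l i) =
        shift_sign l c i * cycle_scalar \<beta> \<alpha> c * (a c * q c ^ next_pos l i)"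
      by (simp only: mult_ac)
    finally show "\<epsilon> * (a c * q c ^ i) * (shift_sign l (\<tau> c) i * cycle_scalar \<beta>' \<alpha>' (\<tau> c)) =
        shift_sign l c i * cycle_scalar \<beta> \<alpha> c * (a c * q c ^ next_pos l i)" .
  next
    fix c i i' assume c: "c \<in> cycles s r" and paired: "paired l c i i'"
    have merge: "a c * q c ^ i * (a (dual_cycle c) * q (dual_cycle c) ^ i') =
        a c * a (dual_cycle c) * q c ^ (i + i')"
      by (cases c) (simp_all add: power_add)
    \<comment> \<open>In a swapped block \<open>l\<close> is odd and \<open>q ^ l = -1 = (-1) ^ l\<close>, so \<open>q\<close> may be replaced by \<open>-1\<close> in
      exponents divisible by \<open>l\<close>.\<close>
    have pow: "(\<epsilon> * \<beta>' (\<eta> j) / \<beta> j) ^ (i + i') = (if S j then (-1) ^ (i + i') else 1)"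
      if j: "j \<in> {1..s}" and dvd: "l dvd i + i'" for j
    proof -
      obtain k where k: "i + i' = l * k" using dvd by (elim dvdE)
      have "(\<epsilon> * \<beta>' (\<eta> j) / \<beta> j) ^ (i + i') = \<delta> j ^ (i + i')"
        by (simp only: k power_mult q_pow[OF j])
      then show ?thesis by (simp add: \<delta>_def)
    qed
    show "a c * q c ^ i * (a (dual_cycle c) * q (dual_cycle c) ^ i') *
        (pairing_sign (\<tau> c) i i' * cycle_scalar \<beta>' \<alpha>' (\<tau> c)) =
        \<epsilon> * (pairing_sign c i i' * cycle_scalar \<beta> \<alpha> c)"
    proof (cases c)
      case (X_cyc j)
      then show ?thesis unfolding merge using c paired pow[of j] nz[of j]
        by (simp add: \<delta>_def power_add del: power_divide)
    next
      case (Y_cyc j)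
      then show ?thesis unfolding merge using c paired pow[of j] nz[of j]
        by (simp add: \<delta>_def power_add)
    next
      case (W_cyc m)
      then show ?thesis unfolding merge using c paired q_pow_W[of m] nz'[of m]
        by (simp add: field_simps)
    qed
  next
    show "paired l (\<tau> c) i i' = paired l c i i'" for c i i' by (cases c) auto
  qed
qed

section \<open>Equivalences respect the cycles\<close>

text \<open>The cyclic shift acts transitively on the positions, so it has no proper invariant subset.\<close>

lemma next_pos_closed_superset:
  assumes "A \<subseteq> {1..l}" "A \<noteq> {}" and closed: "\<And>i. i \<in> A \<Longrightarrow> next_pos l i \<in> A"
  shows "A = {1..l}"
proof -
  have up: "i + n \<in> A" if "i \<in> A" "i + n \<le> l" for i n
    using that(2)
  proof (induction n)
    case (Suc n)
    then show ?case using closed[of "i + n"] by (simp add: next_pos_less)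
  qed (use that in simp)
  obtain i where i: "i \<in> A" using assms(2) by blast
  then have "l \<in> A" using up[of i "l - i"] assms(1) by auto
  then have one: "1 \<in> A" using closed[of l] by (simp add: next_pos_self)
  have "j \<in> A" if "j \<in> {1..l}" for j
    using up[OF one, of "j - 1"] that by simp
  then show ?thesis using assms(1) by blast
qed

lemma bij_betw_next_pos: "bij_betw (next_pos l) {1..l} {1..l}"
proof -
  have sub: "next_pos l ` {1..l} \<subseteq> {1..l}" using next_pos_mem by force
  have "next_pos l ` {1..l} = {1..l}"
  proof (cases "l = 0")
    case False
    then show ?thesis using sub by (intro next_pos_closed_superset) auto
  qed simp
  then show ?thesis by (simp add: bij_betw_def eq_card_imp_inj_on)
qed

lemma ex_paired:
  assumes "0 < l"
  obtains i i' where "i \<in> {1..l}" "i' \<in> {1..l}" "paired l c i i'"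
proof (cases c)
  case (W_cyc m)
  then show thesis using that[of 1 l] assms by simp
qed (use that[of l l] assms in simp_all)

lemma prod_shift_sign:
  assumes "0 < l"
  shows "(\<Prod>i=1..l. shift_sign l c i * (x :: 'f::field)) = cycle_sign l c * x ^ l"
  using assms by (simp add: prod.distrib shift_sign_def)

context block_basis
begin

lemma shift_coeff_nonzero:
  assumes "c \<in> cycles s r"
  shows "shift_sign l c i * cycle_scalar \<beta> \<alpha> c \<noteq> 0"
  using scalar_nonzero[OF assms] by (cases c) (auto simp: shift_sign_def)

lemma pairing_coeff_nonzero:
  assumes "c \<in> cycles s r"
  shows "pairing_sign c i i' * cycle_scalar \<beta> \<alpha> c \<noteq> 0"
  using scalar_nonzero[OF assms] by (cases c) auto

lemma ad_U_nonzero: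
  assumes "c \<in> cycles s r" "i \<in> {1..l}"
  shows "heis_bracket lam (b U_lab) (b (V_lab c i)) \<noteq> 0"
proof -
  have "b (V_lab c (next_pos l i)) \<noteq> 0" using assms(1) next_pos_mem[OF l_pos] by (intro basis_nonzero) auto
  then show ?thesis using shift[OF assms] shift_coeff_nonzero[OF assms(1)] by simp
qed

text \<open>
  Together with \<open>ad_cube_zero\<close>, this singles out the line of \<open>u\<close> among the basis lines in a way that
  automorphisms preserve: \<open>ad u\<close> moves around each cycle forever, while for every other basis vector
  \<open>v\<close> the operator \<open>ad v\<close> leads from \<open>u\<close> through a cycle and \<open>z\<close> to zero.
\<close>

lemma ad_U_cube_nonzero:
  assumes "c \<in> cycles s r" "i \<in> {1..l}"
  shows "heis_bracket lam (b U_lab) (heis_bracket lam (b U_lab) (heis_bracket lam (b U_lab) (b (V_lab c i)))) \<noteq> 0"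
proof -
  have i: "next_pos l i \<in> {1..l}" for i by (rule next_pos_mem[OF l_pos])
  have "heis_bracket lam (b U_lab) (b (V_lab c (next_pos l (next_pos l i)))) \<noteq> 0"
    using assms(1) i by (rule ad_U_nonzero)
  then show ?thesis
    using shift_coeff_nonzero[OF assms(1)]
    by (simp add: shift[OF assms] shift[OF assms(1) i] heis_bracket_scale_right)
qed

lemma ad_cube_zero:
  assumes p: "p \<in> labels l s r" "p \<noteq> U_lab" and q: "q \<in> labels l s r"
  shows "heis_bracket lam (b p) (heis_bracket lam (b p) (heis_bracket lam (b p) (b q))) = 0"
proof (cases p)
  case (V_lab c i)
  then have ci: "c \<in> cycles s r" "i \<in> {1..l}" using p by simp_all
  have V: "\<exists>k. heis_bracket lam (b p) (b (V_lab d j)) = k *s b Z_lab"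
    if "d \<in> cycles s r" "j \<in> {1..l}" for d j
    using pairing[OF ci(1) that(1) ci(2) that(2)] V_lab by (metis vec.scale_zero_left)
  show ?thesis
  proof (cases q)
    case Z_lab
    then show ?thesis by (simp add: central_right heis_bracket_zero)
  next
    case U_lab
    have "\<exists>k. heis_bracket lam (b p) (b U_lab) = k *s b (V_lab c (next_pos l i))"
      using heis_bracket_antisym[of lam "b p"] shift[OF ci] V_lab by (metis vec.scale_minus_left)
    moreover have "next_pos l i \<in> {1..l}" by (rule next_pos_mem[OF l_pos])
    ultimately show ?thesis using V[OF ci(1)] U_lab
      by (metis central_right heis_bracket_scale_right heis_bracket_zero(2) vec.scale_zero_right)
  next
    case (V_lab d j)
    then obtain k where "heis_bracket lam (b p) (b q) = k *s b Z_lab" using V q by auto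
    then show ?thesis by (simp add: central_right heis_bracket_scale_right heis_bracket_zero)
  qed
qed (use p in \<open>simp_all add: central\<close>)

end

text \<open>
  The automorphism induces a bijection \<open>\<pi>\<close> of labels with \<open>f (b p) = g p *s b' (\<pi> p)\<close>. Once \<open>\<pi>\<close> is known
  to fix \<open>z\<close> and \<open>u\<close>, it commutes with the shift by \<open>ad u\<close>, hence maps cycles onto cycles. The factors
  \<open>g\<close> are unknown, but they cancel when the comparison of shift coefficients is multiplied up around
  a cycle; what remains is the equation between \<open>l\<close>-th powers.
\<close>

lemma equivalent_gradings_imp_cycle_bijection:
  assumes "block_basis lam l s r \<beta> \<alpha> b" "block_basis lam l' s' r' \<beta>' \<alpha>' b'"
    and equiv: "equivalent_gradings (heis_bracket lam)
      (block_basis.grading l s r b) (block_basis.grading l' s' r' b')"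
  obtains \<epsilon> \<tau> where "l = l'" "\<epsilon> \<noteq> 0" "bij_betw \<tau> (cycles s r) (cycles s' r')"
    "\<And>c. c \<in> cycles s r \<Longrightarrow> \<tau> (dual_cycle c) = dual_cycle (\<tau> c)"
    "\<And>c. c \<in> cycles s r \<Longrightarrow> cycle_sign l c * cycle_scalar \<beta> \<alpha> c ^ l =
      \<epsilon> ^ l * (cycle_sign l (\<tau> c) * cycle_scalar \<beta>' \<alpha>' (\<tau> c) ^ l)"
proof -
  interpret B: block_basis lam l s r \<beta> \<alpha> b by fact
  interpret B': block_basis lam l' s' r' \<beta>' \<alpha>' b' by fact
  obtain f where "algebra_automorphism (heis_bracket lam) f"
    and \<Gamma>: "bij_betw (\<lambda>V. f ` V) B.grading B'.grading"
    using equiv by (auto simp: equivalent_gradings_def)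
  then have lin: "Vector_Spaces.linear (*s) (*s) f" and "bij f"
    and hom: "\<And>v w. f (heis_bracket lam v w) = heis_bracket lam (f v) (f w)"
    by (simp_all add: algebra_automorphism_def)
  then have "inj f" "surj f" by (simp_all add: bij_def)
  have f0: "f 0 = 0" and f_scale: "\<And>c x. f (c *s x) = c *s f x"
    using lin by (simp_all add: vec.linear_0 vec.linear_scale)
  have f_eq_0: "f v = 0 \<longleftrightarrow> v = 0" for v using \<open>inj f\<close> f0 by (metis injD)
  have "\<exists>q k. q \<in> labels l' s' r' \<and> k \<noteq> 0 \<and> f (b p) = k *s b' q" if p: "p \<in> labels l s r" for p
  proof -
    have "f ` vec.span {b p} \<in> B'.grading"
      using \<Gamma> p by (auto simp: bij_betw_def B.grading_def)
    then obtain q where q: "q \<in> labels l' s' r'" "f ` vec.span {b p} = vec.span {b' q}"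
      by (auto simp: B'.grading_def)
    moreover have "f (b p) \<in> f ` vec.span {b p}" by (simp add: vec.span_base)
    ultimately obtain k where k: "f (b p) = k *s b' q" by (auto simp: vec.span_singleton)
    then have "k \<noteq> 0" using B.basis_nonzero[OF p] f_eq_0[of "b p"] by auto
    then show ?thesis using q k by blast
  qed
  then obtain \<pi> g where \<pi>: "\<And>p. p \<in> labels l s r \<Longrightarrow> \<pi> p \<in> labels l' s' r'"
    and g: "\<And>p. p \<in> labels l s r \<Longrightarrow> g p \<noteq> 0"
    and f: "\<And>p. p \<in> labels l s r \<Longrightarrow> f (b p) = g p *s b' (\<pi> p)"
    by metis
  have \<pi>_inj: "p = q" if "p \<in> labels l s r" "q \<in> labels l s r" "\<pi> p = \<pi> q" for p q
  proof -
    have "f (g q *s b p) = f (g p *s b q)" using that by (simp add: f_scale f mult.commute)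
    then have "g q *s b p = g p *s b q" using \<open>inj f\<close> by (simp add: inj_eq)
    then show ?thesis using B.proportional_imp_eq that g by blast
  qed
  have \<pi>_surj: "\<exists>p\<in>labels l s r. \<pi> p = q" if q: "q \<in> labels l' s' r'" for q
  proof -
    have "vec.span {b' q} \<in> (\<lambda>V. f ` V) ` B.grading"
      using \<Gamma> q by (simp add: bij_betw_def B'.grading_def)
    then obtain p where p: "p \<in> labels l s r" "vec.span {b' q} = f ` vec.span {b p}"
      by (auto simp: B.grading_def)
    then have "f (b p) \<in> vec.span {b' q}" by (simp add: vec.span_base)
    then obtain k where "f (b p) = k *s b' q" by (auto simp: vec.span_singleton)
    then have "g p *s b' (\<pi> p) = k *s b' q" using f p(1) by simp
    then have "\<pi> p = q" using B'.proportional_imp_eq \<pi> p q g by blast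
    then show ?thesis using p by blast
  qed
  note bracket_simps = heis_bracket_scale_left heis_bracket_scale_right vec.scale_scale
  obtain c0 where c0: "c0 \<in> cycles s r" using B.some_cycle by blast
  have \<pi>U: "\<pi> U_lab = U_lab"
  proof (rule ccontr)
    assume "\<pi> U_lab \<noteq> U_lab"
    let ?p = "V_lab c0 (Suc 0)"
    have p: "?p \<in> labels l s r" using c0 B.l_pos by simp
    have "f (heis_bracket lam (b U_lab) (heis_bracket lam (b U_lab) (heis_bracket lam (b U_lab) (b ?p)))) = 0"
      using B'.ad_cube_zero[OF \<pi>[of U_lab] \<open>\<pi> U_lab \<noteq> U_lab\<close> \<pi>[OF p]]
      by (simp add: hom f[OF p] f[of U_lab] bracket_simps)
    then show False using B.ad_U_cube_nonzero[OF c0] B.l_pos unfolding f_eq_0 by auto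
  qed
  \<comment> \<open>The image of \<open>z\<close> is central, whereas \<open>[u', v'] \<noteq> 0\<close> for each \<open>v'\<close> in a cycle.\<close>
  have \<pi>Z: "\<pi> Z_lab = Z_lab"
  proof (cases "\<pi> Z_lab")
    case U_lab
    then show ?thesis using \<pi>_inj[of Z_lab U_lab] \<pi>U by simp
  next
    case (V_lab d j)
    then have dj: "d \<in> cycles s' r'" "j \<in> {1..l'}" using \<pi>[of Z_lab] by simp_all
    obtain v where v: "f v = b' U_lab" using \<open>surj f\<close> by (metis surjD)
    have "heis_bracket lam (f v) (f (b Z_lab)) = 0"
      by (simp add: B.central_right f0 flip: hom)
    then have "heis_bracket lam (b' U_lab) (b' (V_lab d j)) = 0"
      using g[of Z_lab] by (simp add: f V_lab v bracket_simps)
    then show ?thesis using B'.ad_U_nonzero[OF dj] by simp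
  qed
  have "\<exists>d j. \<pi> (V_lab c i) = V_lab d j" if "c \<in> cycles s r" "i \<in> {1..l}" for c i
    using \<pi>_inj[of "V_lab c i" Z_lab] \<pi>_inj[of "V_lab c i" U_lab] that \<pi>U \<pi>Z
    by (cases "\<pi> (V_lab c i)") auto
  then obtain T \<rho> where \<pi>V: "\<And>c i. c \<in> cycles s r \<Longrightarrow> i \<in> {1..l} \<Longrightarrow>
      \<pi> (V_lab c i) = V_lab (T c i) (\<rho> c i)"
    by metis
  have T_mem: "T c i \<in> cycles s' r'" and \<rho>_mem: "\<rho> c i \<in> {1..l'}"
    if "c \<in> cycles s r" "i \<in> {1..l}" for c i
    using \<pi>[of "V_lab c i"] \<pi>V[OF that] that by auto
  have fV: "f (b (V_lab c i)) = g (V_lab c i) *s b' (V_lab (T c i) (\<rho> c i))"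
    if "c \<in> cycles s r" "i \<in> {1..l}" for c i
    using f[of "V_lab c i"] \<pi>V[OF that] that by simp
  define \<epsilon> where "\<epsilon> = g U_lab"
  have \<epsilon>: "\<epsilon> \<noteq> 0" using g by (simp add: \<epsilon>_def)
  have nxt: "next_pos l i \<in> {1..l}" "next_pos l' i \<in> {1..l'}" for i
    using next_pos_mem B.l_pos B'.l_pos by blast+
  \<comment> \<open>Compare \<open>f [u, v]\<close> with \<open>[f u, f v]\<close>: both are nonzero multiples of a single basis vector.\<close>
  have step: "T c (next_pos l i) = T c i" "\<rho> c (next_pos l i) = next_pos l' (\<rho> c i)"
    "\<epsilon> * g (V_lab c i) * (shift_sign l' (T c i) (\<rho> c i) * cycle_scalar \<beta>' \<alpha>' (T c i)) =
      shift_sign l c i * cycle_scalar \<beta> \<alpha> c * g (V_lab c (next_pos l i))"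
    if ci: "c \<in> cycles s r" "i \<in> {1..l}" for c i
  proof -
    let ?k = "\<epsilon> * g (V_lab c i) * (shift_sign l' (T c i) (\<rho> c i) * cycle_scalar \<beta>' \<alpha>' (T c i))"
    let ?k' = "shift_sign l c i * cycle_scalar \<beta> \<alpha> c * g (V_lab c (next_pos l i))"
    have "?k' *s b' (V_lab (T c (next_pos l i)) (\<rho> c (next_pos l i))) =
        f (heis_bracket lam (b U_lab) (b (V_lab c i)))"
      by (simp add: B.shift[OF ci] f_scale fV[OF ci(1) nxt(1)])
    also have "\<dots> = ?k *s b' (V_lab (T c i) (next_pos l' (\<rho> c i)))"
      by (simp add: hom f[of U_lab] \<pi>U fV[OF ci] bracket_simps
          B'.shift[OF T_mem[OF ci] \<rho>_mem[OF ci]] \<epsilon>_def mult_ac)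
    finally have eq: "?k' *s b' (V_lab (T c (next_pos l i)) (\<rho> c (next_pos l i))) =
        ?k *s b' (V_lab (T c i) (next_pos l' (\<rho> c i)))" .
    have "g (V_lab c (next_pos l i)) \<noteq> 0" using g ci(1) nxt by simp
    then have "?k' \<noteq> 0" using B.shift_coeff_nonzero[OF ci(1)] by simp
    moreover have mem: "V_lab (T c (next_pos l i)) (\<rho> c (next_pos l i)) \<in> labels l' s' r'"
        "V_lab (T c i) (next_pos l' (\<rho> c i)) \<in> labels l' s' r'"
      using T_mem \<rho>_mem ci nxt by simp_all
    ultimately have same: "V_lab (T c (next_pos l i)) (\<rho> c (next_pos l i)) =
        V_lab (T c i) (next_pos l' (\<rho> c i))"
      using B'.proportional_imp_eq eq by blast
    then show "T c (next_pos l i) = T c i" "\<rho> c (next_pos l i) = next_pos l' (\<rho> c i)" by simp_all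
    show "?k = ?k'" using eq B'.basis_nonzero[OF mem(2)] unfolding same vec.scale_cancel_right by simp
  qed
  define \<tau> where "\<tau> c = T c 1" for c
  have T_eq: "T c i = \<tau> c" if "c \<in> cycles s r" "i \<in> {1..l}" for c i
    using that(2)
  proof (induction i)
    case (Suc i)
    show ?case
    proof (cases "i = 0")
      case False
      then show ?thesis using Suc step(1)[OF that(1), of i] by (simp add: next_pos_less)
    qed (simp add: \<tau>_def)
  qed simp
  have \<tau>_mem: "\<tau> c \<in> cycles s' r'" if "c \<in> cycles s r" for c
    using T_mem[OF that, of 1] B.l_pos by (simp add: \<tau>_def)
  have \<rho>_inj: "inj_on (\<rho> c) {1..l}" if "c \<in> cycles s r" for c
  proof (rule inj_onI)
    fix i j assume "i \<in> {1..l}" "j \<in> {1..l}" "\<rho> c i = \<rho> c j"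
    then show "i = j" using that T_eq \<pi>V \<pi>_inj[of "V_lab c i" "V_lab c j"] by simp
  qed
  have \<rho>_image: "\<rho> c ` {1..l} = {1..l'}" if "c \<in> cycles s r" for c
  proof (rule next_pos_closed_superset)
    show "next_pos l' i \<in> \<rho> c ` {1..l}" if i: "i \<in> \<rho> c ` {1..l}" for i
    proof -
      obtain j where j: "j \<in> {1..l}" "i = \<rho> c j" using i by blast
      show ?thesis using step(2)[OF \<open>c \<in> cycles s r\<close> j(1)] nxt(1)[of j] j(2) by (metis imageI)
    qed
  qed (use \<rho>_mem[OF that] B.l_pos in auto)
  have l: "l = l'"
    using card_image[OF \<rho>_inj[OF c0]] \<rho>_image[OF c0] by simp
  have \<tau>_inj: "inj_on \<tau> (cycles s r)"
  proof (rule inj_onI)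
    fix c d assume cd: "c \<in> cycles s r" "d \<in> cycles s r" "\<tau> c = \<tau> d"
    have one: "1 \<in> {1..l}" using B.l_pos by simp
    then obtain i where i: "i \<in> {1..l}" "\<rho> d i = \<rho> c 1"
      using \<rho>_mem[OF cd(1) one] \<rho>_image[OF cd(2)] by (metis imageE)
    then have "\<pi> (V_lab c 1) = \<pi> (V_lab d i)" using cd T_eq one by (simp add: \<pi>V)
    then show "c = d" using \<pi>_inj[of "V_lab c 1" "V_lab d i"] cd one i by simp
  qed
  moreover have "cycles s' r' \<subseteq> \<tau> ` cycles s r"
  proof
    fix d assume "d \<in> cycles s' r'"
    then obtain p where p: "p \<in> labels l s r" "\<pi> p = V_lab d 1"
      using \<pi>_surj[of "V_lab d 1"] B'.l_pos by auto
    then obtain c i where ci: "p = V_lab c i" using \<pi>U \<pi>Z by (cases p) auto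
    then have "d = \<tau> c" "c \<in> cycles s r" using p \<pi>V[of c i] T_eq[of c i] by auto
    then show "d \<in> \<tau> ` cycles s r" by (rule image_eqI)
  qed
  ultimately have bij: "bij_betw \<tau> (cycles s r) (cycles s' r')"
    using \<tau>_mem by (auto simp: bij_betw_def)
  have dual: "\<tau> (dual_cycle c) = dual_cycle (\<tau> c)" if c: "c \<in> cycles s r" for c
  proof (rule ccontr)
    assume ne: "\<tau> (dual_cycle c) \<noteq> dual_cycle (\<tau> c)"
    obtain i i' where i: "i \<in> {1..l}" "i' \<in> {1..l}" "paired l c i i'" using ex_paired[OF B.l_pos] .
    have d: "dual_cycle c \<in> cycles s r" using c by simp
    have "f (heis_bracket lam (b (V_lab c i)) (b (V_lab (dual_cycle c) i'))) = 0"
      using ne by (simp add: hom fV[OF c i(1)] fV[OF d i(2)] T_eq[OF c i(1)] T_eq[OF d i(2)]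
          bracket_simps B'.pairing[OF \<tau>_mem[OF c] \<tau>_mem[OF d] \<rho>_mem[OF c i(1)] \<rho>_mem[OF d i(2)]])
    then have "(pairing_sign c i i' * cycle_scalar \<beta> \<alpha> c) *s b Z_lab = 0"
      unfolding f_eq_0 using B.pairing[OF c d i(1,2)] i(3) by simp
    then show False using B.pairing_coeff_nonzero[OF c] B.basis_nonzero[of Z_lab]
      by (simp add: vec.scale_eq_0_iff)
  qed
  have "cycle_sign l c * cycle_scalar \<beta> \<alpha> c ^ l =
      \<epsilon> ^ l * (cycle_sign l (\<tau> c) * cycle_scalar \<beta>' \<alpha>' (\<tau> c) ^ l)" if c: "c \<in> cycles s r" for c
  proof -
    define m where "m i = shift_sign l c i * cycle_scalar \<beta> \<alpha> c" for i
    define m' where "m' i = shift_sign l (\<tau> c) i * cycle_scalar \<beta>' \<alpha>' (\<tau> c)" for i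
    let ?G = "\<Prod>i=1..l. g (V_lab c i)"
    have "(\<Prod>i=1..l. \<epsilon> * g (V_lab c i) * m' (\<rho> c i)) = (\<Prod>i=1..l. m i * g (V_lab c (next_pos l i)))"
      using step(3)[OF c] T_eq[OF c] l by (intro prod.cong) (auto simp: m_def m'_def)
    moreover have "(\<Prod>i=1..l. m' (\<rho> c i)) = (\<Prod>i=1..l. m' i)"
      by (rule prod.reindex_bij_betw) (use \<rho>_inj[OF c] \<rho>_image[OF c] l in \<open>simp add: bij_betw_def\<close>)
    moreover have "(\<Prod>i=1..l. g (V_lab c (next_pos l i))) = ?G"
      by (rule prod.reindex_bij_betw) (rule bij_betw_next_pos)
    ultimately have "?G * (\<epsilon> ^ l * (\<Prod>i=1..l. m' i)) = ?G * (\<Prod>i=1..l. m i)"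
      by (simp add: prod.distrib mult_ac)
    moreover have "?G \<noteq> 0" using g c by simp
    ultimately have "(\<Prod>i=1..l. m i) = \<epsilon> ^ l * (\<Prod>i=1..l. m' i)" by simp
    then show ?thesis by (simp only: m_def m'_def prod_shift_sign[OF B.l_pos])
  qed
  then show thesis using that l \<epsilon> bij dual by blast
qed

text \<open>
  The self-dual cycles are those of type II, so a bijection commuting with duality maps them to each
  other and permutes the dual pairs of type I. This gives \<open>r \<le> r'\<close> and \<open>s \<le> s'\<close>, and the total number
  \<open>2 s + r\<close> of cycles forces equality. The permutations are inverse to the induced ones, so that \<open>\<eta>\<close> and
  \<open>\<sigma>\<close> act on the indices of the source.
\<close>

lemma dual_equivariant_bijection:
  assumes bij: "bij_betw \<tau> (cycles s r) (cycles s' r')"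
    and dual: "\<And>c. c \<in> cycles s r \<Longrightarrow> \<tau> (dual_cycle c) = dual_cycle (\<tau> c)"
  obtains \<eta> \<sigma> where "s = s'" "r = r'" "\<eta> permutes {1..s}" "\<sigma> permutes {1..r}"
    "\<And>j. j \<in> {1..s} \<Longrightarrow> \<tau> (X_cyc (\<eta> j)) \<in> {X_cyc j, Y_cyc j}"
    "\<And>i. i \<in> {1..r} \<Longrightarrow> \<tau> (W_cyc (\<sigma> i)) = W_cyc i"
proof -
  have \<tau>_mem: "\<tau> c \<in> cycles s' r'" if "c \<in> cycles s r" for c using bij that by (auto simp: bij_betw_def)
  have \<tau>_eq: "\<tau> c = \<tau> d \<longleftrightarrow> c = d" if "c \<in> cycles s r" "d \<in> cycles s r" for c d
    using bij that by (auto simp: bij_betw_def dest: inj_onD)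
  have "\<exists>m. m \<in> {1..r'} \<and> \<tau> (W_cyc i) = W_cyc m" if "i \<in> {1..r}" for i
    using dual[of "W_cyc i"] \<tau>_mem[of "W_cyc i"] that by (cases "\<tau> (W_cyc i)") auto
  then obtain \<sigma> where \<sigma>: "\<And>i. i \<in> {1..r} \<Longrightarrow> \<sigma> i \<in> {1..r'} \<and> \<tau> (W_cyc i) = W_cyc (\<sigma> i)" by metis
  have "\<exists>m. m \<in> {1..s'} \<and> \<tau> (X_cyc j) \<in> {X_cyc m, Y_cyc m}" if "j \<in> {1..s}" for j
    using dual[of "X_cyc j"] \<tau>_mem[of "X_cyc j"] \<tau>_eq[of "X_cyc j" "Y_cyc j"] that
    by (cases "\<tau> (X_cyc j)") auto
  then obtain \<eta> where \<eta>: "\<And>j. j \<in> {1..s} \<Longrightarrow> \<eta> j \<in> {1..s'} \<and> \<tau> (X_cyc j) \<in> {X_cyc (\<eta> j), Y_cyc (\<eta> j)}" by metis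
  have \<sigma>_inj: "inj_on \<sigma> {1..r}"
    using \<sigma> \<tau>_eq by (intro inj_onI) (metis block_cycle.inject(3) cycles_simps(3))
  have \<eta>_inj: "inj_on \<eta> {1..s}"
  proof (rule inj_onI)
    fix i j assume ij: "i \<in> {1..s}" "j \<in> {1..s}" "\<eta> i = \<eta> j"
    then have "\<tau> (X_cyc i) = \<tau> (X_cyc j) \<or> \<tau> (X_cyc i) = \<tau> (Y_cyc j)"
      using \<eta>[OF ij(1)] \<eta>[OF ij(2)] dual[of "X_cyc j"] by auto
    then show "i = j" using ij \<tau>_eq[of "X_cyc i" "X_cyc j"] \<tau>_eq[of "X_cyc i" "Y_cyc j"] by simp
  qed
  have \<sigma>_into: "\<sigma> ` {1..r} \<subseteq> {1..r'}" and \<eta>_into: "\<eta> ` {1..s} \<subseteq> {1..s'}" using \<sigma> \<eta> by blast+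
  then have "r \<le> r'" "s \<le> s'"
    using card_inj_on_le[OF \<sigma>_inj \<sigma>_into] card_inj_on_le[OF \<eta>_inj \<eta>_into] by simp_all
  moreover have "2 * s + r = 2 * s' + r'" using bij_betw_same_card[OF bij] by (simp add: card_cycles)
  ultimately have sr: "s = s'" "r = r'" by simp_all
  have inverse: "\<exists>\<theta>. \<theta> permutes {1..n} \<and> (\<forall>i\<in>{1..n}. \<kappa> (\<theta> i) = i)"
    if "inj_on \<kappa> {1..n}" "\<kappa> ` {1..n} \<subseteq> {1..n}" for \<kappa> :: "nat \<Rightarrow> nat" and n
  proof -
    have "bij_betw \<kappa> {1..n} {1..n}" using that by (simp add: bij_betw_def endo_inj_surj)
    then have p: "restrict_id \<kappa> {1..n} permutes {1..n}" by (rule permutes_restrict_id)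
    let ?\<theta> = "inv_into UNIV (restrict_id \<kappa> {1..n})"
    have \<theta>: "?\<theta> permutes {1..n}" using p by (rule permutes_inv)
    have "\<kappa> (?\<theta> i) = i" if "i \<in> {1..n}" for i
      using that permutes_in_image[OF \<theta>, of i] permutes_inverses(1)[OF p, of i]
      by (simp add: restrict_id_def del: atLeastAtMost_iff)
    with \<theta> show ?thesis by blast
  qed
  obtain \<eta>' where \<eta>': "\<eta>' permutes {1..s}" "\<And>j. j \<in> {1..s} \<Longrightarrow> \<eta> (\<eta>' j) = j"
    using inverse[OF \<eta>_inj] \<eta>_into sr(1) by blast
  obtain \<sigma>' where \<sigma>': "\<sigma>' permutes {1..r}" "\<And>i. i \<in> {1..r} \<Longrightarrow> \<sigma> (\<sigma>' i) = i"
    using inverse[OF \<sigma>_inj] \<sigma>_into sr(2) by blast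
  show thesis
  proof (rule that[OF sr \<eta>'(1) \<sigma>'(1)])
    show "\<tau> (X_cyc (\<eta>' j)) \<in> {X_cyc j, Y_cyc j}" if "j \<in> {1..s}" for j
      using \<eta>[of "\<eta>' j"] \<eta>'(2)[OF that] permutes_in_image[OF \<eta>'(1), of j] that by auto
    show "\<tau> (W_cyc (\<sigma>' i)) = W_cyc i" if "i \<in> {1..r}" for i
      using \<sigma>[of "\<sigma>' i"] \<sigma>'(2)[OF that] permutes_in_image[OF \<sigma>'(1), of i] that by auto
  qed
qed

section \<open>The classification\<close>

theorem theorem5:
  fixes lam :: "'f::{alg_closed_field, field_char_0} ^ 'k::finite"
    and l s r l' s' r' :: nat
    and \<beta> \<alpha> \<beta>' \<alpha>' :: "nat \<Rightarrow> 'f"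
    and \<Gamma> \<Gamma>' :: "('f, 'k) heis set set"
  assumes "\<forall>i. lam $ i \<noteq> 0"
    and "fine_grading (heis_bracket lam) \<Gamma>"
    and "is_block_grading lam l s r \<beta> \<alpha> \<Gamma>"
    and "fine_grading (heis_bracket lam) \<Gamma>'"
    and "is_block_grading lam l' s' r' \<beta>' \<alpha>' \<Gamma>'"
  shows "equivalent_gradings (heis_bracket lam) \<Gamma> \<Gamma>' \<longleftrightarrow>
    l = l' \<and> s = s' \<and> r = r' \<and>
    (\<exists>\<epsilon> \<eta> \<sigma>. \<epsilon> \<noteq> 0 \<and> \<eta> permutes {1..s} \<and> \<sigma> permutes {1..r} \<and>
       (\<forall>j\<in>{1..s}.
          if even l then hat_class l (\<epsilon> * \<beta>' j) = hat_class l (\<beta> (\<eta> j))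
          else tilde_class l (\<epsilon> * \<beta>' j) = tilde_class l (\<beta> (\<eta> j))) \<and>
       (\<forall>i\<in>{1..r}. hat_class l (\<epsilon> * \<alpha>' i) = hat_class l (\<alpha> (\<sigma> i))))"
proof -
  obtain b where b: "block_basis lam l s r \<beta> \<alpha> b" "\<Gamma> = block_basis.grading l s r b"
    using block_grading_has_block_basis[OF assms(1,3)] .
  obtain b' where b': "block_basis lam l' s' r' \<beta>' \<alpha>' b'" "\<Gamma>' = block_basis.grading l' s' r' b'"
    using block_grading_has_block_basis[OF assms(1,5)] .
  have l: "0 < l" using b(1) by (rule block_basis.l_pos)
  have hat: "hat_class l x = hat_class l y \<longleftrightarrow> x ^ l = y ^ l"
    and tilde: "tilde_class l x = tilde_class l y \<longleftrightarrow> x ^ (2 * l) = y ^ (2 * l)" for x y :: 'f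
    using l by (simp_all add: hat_class_def tilde_class_def root_class_eq_iff)
  have square: "x ^ (2 * l) = y ^ (2 * l) \<longleftrightarrow> x ^ l = y ^ l \<or> x ^ l = - (y ^ l)" for x y :: 'f
    using power2_eq_iff[of "x ^ l" "y ^ l"] by (simp add: mult.commute[of 2] power_mult)
  show ?thesis
  proof (intro iffI)
    assume "equivalent_gradings (heis_bracket lam) \<Gamma> \<Gamma>'"
    then obtain \<epsilon> \<tau> where l': "l = l'" and \<epsilon>: "\<epsilon> \<noteq> 0"
      and bij: "bij_betw \<tau> (cycles s r) (cycles s' r')"
      and dual: "\<And>c. c \<in> cycles s r \<Longrightarrow> \<tau> (dual_cycle c) = dual_cycle (\<tau> c)"
      and pow: "\<And>c. c \<in> cycles s r \<Longrightarrow> cycle_sign l c * cycle_scalar \<beta> \<alpha> c ^ l =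
        \<epsilon> ^ l * (cycle_sign l (\<tau> c) * cycle_scalar \<beta>' \<alpha>' (\<tau> c) ^ l)"
      using equivalent_gradings_imp_cycle_bijection[OF b(1) b'(1)] unfolding b(2) b'(2) by metis
    obtain \<eta> \<sigma> where sr: "s = s'" "r = r'" and \<eta>: "\<eta> permutes {1..s}" and \<sigma>: "\<sigma> permutes {1..r}"
      and X: "\<And>j. j \<in> {1..s} \<Longrightarrow> \<tau> (X_cyc (\<eta> j)) \<in> {X_cyc j, Y_cyc j}"
      and W: "\<And>i. i \<in> {1..r} \<Longrightarrow> \<tau> (W_cyc (\<sigma> i)) = W_cyc i"
      using dual_equivariant_bijection[OF bij dual] by metis
    have \<beta>: "(\<epsilon> * \<beta>' j) ^ l = \<beta> (\<eta> j) ^ l \<or> odd l \<and> (\<epsilon> * \<beta>' j) ^ l = - (\<beta> (\<eta> j) ^ l)"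
      if "j \<in> {1..s}" for j
      using X[OF that] pow[of "X_cyc (\<eta> j)"] permutes_in_image[OF \<eta>, of j] that
      by (cases "even l") (auto simp: power_mult_distrib)
    have \<alpha>: "(\<epsilon> * \<alpha>' i) ^ l = \<alpha> (\<sigma> i) ^ l" if "i \<in> {1..r}" for i
      using W[OF that] pow[of "W_cyc (\<sigma> i)"] permutes_in_image[OF \<sigma>, of i] that
      by (simp add: power_mult_distrib)
    have "\<forall>j\<in>{1..s}. if even l then hat_class l (\<epsilon> * \<beta>' j) = hat_class l (\<beta> (\<eta> j))
        else tilde_class l (\<epsilon> * \<beta>' j) = tilde_class l (\<beta> (\<eta> j))"
      unfolding hat tilde square using \<beta> by (metis (full_types))
    moreover have "\<forall>i\<in>{1..r}. hat_class l (\<epsilon> * \<alpha>' i) = hat_class l (\<alpha> (\<sigma> i))"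
      using \<alpha> unfolding hat by blast
    ultimately show "l = l' \<and> s = s' \<and> r = r' \<and>
      (\<exists>\<epsilon> \<eta> \<sigma>. \<epsilon> \<noteq> 0 \<and> \<eta> permutes {1..s} \<and> \<sigma> permutes {1..r} \<and>
        (\<forall>j\<in>{1..s}.
          if even l then hat_class l (\<epsilon> * \<beta>' j) = hat_class l (\<beta> (\<eta> j))
          else tilde_class l (\<epsilon> * \<beta>' j) = tilde_class l (\<beta> (\<eta> j))) \<and>
        (\<forall>i\<in>{1..r}. hat_class l (\<epsilon> * \<alpha>' i) = hat_class l (\<alpha> (\<sigma> i))))"
      using l' sr \<epsilon> \<eta> \<sigma> by blast
  next
    assume "l = l' \<and> s = s' \<and> r = r' \<and>
      (\<exists>\<epsilon> \<eta> \<sigma>. \<epsilon> \<noteq> 0 \<and> \<eta> permutes {1..s} \<and> \<sigma> permutes {1..r} \<and>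
        (\<forall>j\<in>{1..s}.
          if even l then hat_class l (\<epsilon> * \<beta>' j) = hat_class l (\<beta> (\<eta> j))
          else tilde_class l (\<epsilon> * \<beta>' j) = tilde_class l (\<beta> (\<eta> j))) \<and>
        (\<forall>i\<in>{1..r}. hat_class l (\<epsilon> * \<alpha>' i) = hat_class l (\<alpha> (\<sigma> i))))"
    then obtain \<epsilon> \<eta> \<sigma> where eq: "l' = l" "s' = s" "r' = r" and \<epsilon>: "\<epsilon> \<noteq> 0"
      and \<eta>: "\<eta> permutes {1..s}" and \<sigma>: "\<sigma> permutes {1..r}"
      and \<beta>: "\<forall>j\<in>{1..s}. if even l then hat_class l (\<epsilon> * \<beta>' j) = hat_class l (\<beta> (\<eta> j))
          else tilde_class l (\<epsilon> * \<beta>' j) = tilde_class l (\<beta> (\<eta> j))"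
      and \<alpha>: "\<forall>i\<in>{1..r}. hat_class l (\<epsilon> * \<alpha>' i) = hat_class l (\<alpha> (\<sigma> i))"
      by blast
    let ?\<eta> = "inv_into UNIV \<eta>" and ?\<sigma> = "inv_into UNIV \<sigma>"
    have "(\<epsilon> * \<beta>' (?\<eta> j)) ^ l = \<beta> j ^ l \<or> odd l \<and> (\<epsilon> * \<beta>' (?\<eta> j)) ^ l = - (\<beta> j ^ l)"
      if "j \<in> {1..s}" for j
    proof -
      have "?\<eta> j \<in> {1..s}" using permutes_in_image[OF permutes_inv[OF \<eta>]] that by blast
      from bspec[OF \<beta> this] show ?thesis
        unfolding hat tilde square permutes_inverses(1)[OF \<eta>] by (auto split: if_splits)
    qed
    moreover have "(\<epsilon> * \<alpha>' (?\<sigma> i)) ^ l = \<alpha> i ^ l" if "i \<in> {1..r}" for i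
    proof -
      have "?\<sigma> i \<in> {1..r}" using permutes_in_image[OF permutes_inv[OF \<sigma>]] that by blast
      from bspec[OF \<alpha> this] show ?thesis unfolding hat permutes_inverses(1)[OF \<sigma>] .
    qed
    ultimately show "equivalent_gradings (heis_bracket lam) \<Gamma> \<Gamma>'"
      using equivalent_gradings_if_scalars_match[OF b(1) b'(1)[unfolded eq] \<epsilon>
          permutes_inv[OF \<eta>] permutes_inv[OF \<sigma>]]
      unfolding b(2) b'(2)[unfolded eq] by blast
  qed
qed

end
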